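(* There exist two distances $d_1,d_2$ on the Heisenberg group $\mathbb{H}$ that are biLipschitz equivalent to $d_{cc}$ such that (1) the distance $d_1$ is left-invariant, but no blow-up of $d_1$ is self-similar; (2) no blow-up of $d_2$ is left-invariant nor self-similar (i.e. every blow-up of $d_2$ is neither left-invariant nor self-similar).
   Context: $\mathbb{H}$ is $\mathbb{R}^3$ with the group law $p\cdot q = (x_p+x_q,\, y_p+y_q,\, z_p+z_q+\tfrac12(x_py_q-y_px_q))$, and $\delta_\lambda(x,y,z)=(\lambda x,\lambda y,\lambda^2z)$ for $\lambda>0$. The Carnot-Carathéodory (subRiemannian) distance $d_{cc}$ is the left-invariant distance for which $d_{cc}(p,q)$ is the infimum of lengths of absolutely continuous curves from $p$ to $q$ that are a.e. tangent to the span of the left-invariant vector fields $X=\partial_x-\frac y2\partial_z$, $Y=\partial_y+\frac x2\partial_z$, the length being computed by declaring $X,Y$ orthonormal. A distance $d$ is biLipschitz equivalent to $d_{cc}$ if there is $L\ge1$ with $\frac1Ld_{cc}\le d\le Ld_{cc}$ on $\mathbb{H}\times\mathbb{H}$. A (semi-)distance $d$ on $\mathbb{H}$ is left-invariant if $d(gp,gq)=d(p,q)$ for all $g,p,q\in\mathbb{H}$; it is self-similar if there exists some $\lambda>1$ with $d(\delta_\lambda(p),\delta_\lambda(q))=\lambda d(p,q)$ for all $p,q\in\mathbb{H}$. A blow-up of a distance $d$ is any pointwise limit on $\mathbb{H}\times\mathbb{H}$ of functions $$(p_1,p_2)\mapsto\frac1{\lambda_j}d\big(q_j\delta_{\lambda_j}(p_1),\,q_j\delta_{\lambda_j}(p_2)\big),$$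 as $j\to\infty$, where $\lambda_j>0$, $\lambda_j\to0$ and $q_j\in\mathbb{H}$. *)

theory Defs
  imports "HOL-Analysis.Analysis"
begin

section \<open>The Heisenberg group\<close>

type_synonym heis = "real \<times> real \<times> real"

fun hmul :: "heis \<Rightarrow> heis \<Rightarrow> heis" where
  "hmul (x, y, z) (x', y', z') = (x + x', y + y', z + z' + (x * y' - y * x') / 2)"

fun hdil :: "real \<Rightarrow> heis \<Rightarrow> heis" where
  "hdil r (x, y, z) = (r * x, r * y, r\<^sup>2 * z)"

text \<open>The left-invariant fields \<open>X = \<partial>\<^sub>x - (y/2) \<partial>\<^sub>z\<close> and \<open>Y = \<partial>\<^sub>y + (x/2) \<partial>\<^sub>z\<close>,
  written as maps sending a point to the coordinates of the tangent vector there.\<close>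

fun fieldX :: "heis \<Rightarrow> heis" where
  "fieldX (x, y, z) = (1, 0, - y / 2)"

fun fieldY :: "heis \<Rightarrow> heis" where
  "fieldY (x, y, z) = (0, 1, x / 2)"


section \<open>The Carnot-Caratheodory distance\<close>

text \<open>The usual epsilon-delta definition: a division of a subset of \<open>S\<close> is a finite family of
  non-overlapping compact intervals \<open>K = {Inf K..Sup K}\<close> contained in \<open>S\<close>.\<close>

definition abs_continuous_on :: "real set \<Rightarrow> (real \<Rightarrow> 'a::real_normed_vector) \<Rightarrow> bool" where
  "abs_continuous_on S f \<longleftrightarrow>
     (\<forall>\<epsilon>>0. \<exists>\<delta>>0. \<forall>\<D> T. \<D> division_of T \<and> T \<subseteq> S \<and> (\<Sum>K\<in>\<D>. measure lborel K) < \<delta> \<longrightarrow>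
        (\<Sum>K\<in>\<D>. norm (f (Sup K) - f (Inf K))) < \<epsilon>)"

text \<open>\<open>horizontal_curve \<gamma> a b\<close>: \<open>\<gamma>\<close> is absolutely continuous on the unit interval, and at almost
  every time its velocity is \<open>a X + b Y\<close>, i.e. lies in the span of \<open>X, Y\<close> with
  coefficients \<open>a t\<close>, \<open>b t\<close>. As \<open>X, Y\<close> are declared orthonormal, the speed is
  \<open>sqrt (a\<^sup>2 + b\<^sup>2)\<close>.\<close>

definition horizontal_curve :: "(real \<Rightarrow> heis) \<Rightarrow> (real \<Rightarrow> real) \<Rightarrow> (real \<Rightarrow> real) \<Rightarrow> bool" where
  "horizontal_curve \<gamma> a b \<longleftrightarrow>
     abs_continuous_on {0..1} \<gamma> \<and>
     (AE t in lebesgue_on {0..1}.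
        (\<gamma> has_vector_derivative (a t *\<^sub>R fieldX (\<gamma> t) + b t *\<^sub>R fieldY (\<gamma> t)))
          (at t within {0..1}))"

text \<open>Speeds of absolutely continuous curves are integrable, so requiring \<open>has_integral\<close> excludes no
  curve. Any two points are joined by a horizontal curve, so the infimum is over a nonempty set.\<close>

definition d_cc :: "heis \<Rightarrow> heis \<Rightarrow> real" where
  "d_cc p q = Inf {l. \<exists>\<gamma> a b. horizontal_curve \<gamma> a b \<and> \<gamma> 0 = p \<and> \<gamma> 1 = q \<and>
                        ((\<lambda>t. sqrt ((a t)\<^sup>2 + (b t)\<^sup>2)) has_integral l) {0..1}}"


section \<open>Distances on the Heisenberg group\<close>

definition bilipschitz_equiv :: "('a \<Rightarrow> 'a \<Rightarrow> real) \<Rightarrow> ('a \<Rightarrow> 'a \<Rightarrow> real) \<Rightarrow> bool" where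
  "bilipschitz_equiv d d' \<longleftrightarrow> (\<exists>L\<ge>1. \<forall>p q. d' p q / L \<le> d p q \<and> d p q \<le> L * d' p q)"

definition left_invariant :: "(heis \<Rightarrow> heis \<Rightarrow> real) \<Rightarrow> bool" where
  "left_invariant d \<longleftrightarrow> (\<forall>g p q. d (hmul g p) (hmul g q) = d p q)"

definition self_similar :: "(heis \<Rightarrow> heis \<Rightarrow> real) \<Rightarrow> bool" where
  "self_similar d \<longleftrightarrow> (\<exists>r>1. \<forall>p q. d (hdil r p) (hdil r q) = r * d p q)"

definition is_blow_up :: "(heis \<Rightarrow> heis \<Rightarrow> real) \<Rightarrow> (heis \<Rightarrow> heis \<Rightarrow> real) \<Rightarrow> bool" where
  "is_blow_up d D \<longleftrightarrow>
     (\<exists>(r :: nat \<Rightarrow> real) (g :: nat \<Rightarrow> heis).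
        (\<forall>j. r j > 0) \<and> r \<longlonglongrightarrow> 0 \<and>
        (\<forall>p1 p2. (\<lambda>j. (1 / r j) *
            d (hmul (g j) (hdil (r j) p1)) (hmul (g j) (hdil (r j) p2))) \<longlonglongrightarrow> D p1 p2))"

end

theory Submission
  imports Defs
begin

text \<open>
  Both distances have the form \<open>max (K |\<Delta>(x, y)|) (\<psi> |z|)\<close>, where \<open>z\<close> is the vertical coordinate
  of \<open>p\<^sup>-\<^sup>1 q\<close> and \<open>\<psi>\<close> is the inverse of
  \<open>a \<mapsto> a\<^sup>2 (8 + sin (sqrt 2 ln a) + (1 - cos (ln a)) w)\<close>. The factor next to \<open>a\<^sup>2\<close> varies slowly in
  \<open>ln a\<close>, so this function is superadditive with a gain \<open>5 a b\<close>, and the triangle inequality follows.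
  For \<open>d\<^sub>1\<close> one takes \<open>w = 1\<close>. For \<open>d\<^sub>2\<close> one takes a sine of the \<open>x\<close>-coordinate of the base point,
  with frequency about \<open>1 / a\<close>, constant on each interval
  \<open>2 \<pi> k \<le> ln a < 2 \<pi> (k + 1)\<close>. Blowing up only shifts the phases. For \<open>d\<^sub>2\<close> the wave
  takes all its values in \<open>[-1, 1]\<close> as the base point varies, so no blow-up is left-invariant. In both
  cases the extreme value \<open>w = 1\<close> is attained, and a self-similar blow-up would make
  \<open>sin (sqrt 2 s + v) - cos (s + u)\<close> periodic in \<open>s\<close>, contradicting the irrationality of \<open>sqrt 2\<close>.
  The comparison with \<open>d\<^sub>c\<^sub>c\<close> only needs that \<open>d\<^sub>c\<^sub>c\<close> is comparable to
  \<open>|\<Delta>(x, y)| + sqrt |z|\<close>.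
\<close>

section \<open>The fundamental theorem of calculus for absolutely continuous curves\<close>

lemma abs_continuous_on_subset:
  "abs_continuous_on S f \<Longrightarrow> T \<subseteq> S \<Longrightarrow> abs_continuous_on T f"
  unfolding abs_continuous_on_def by (meson order_trans)

text \<open>Deals with the null set where the derivative may fail to exist. \<open>N\<close> lies in
  an open \<open>U\<close> of measure below the \<open>\<delta>\<close> of absolute continuity, so
  non-overlapping intervals inside \<open>U\<close> have total length below
  \<open>\<delta>\<close>.\<close>

lemma abs_continuous_on_small_tags:
  fixes f :: "real \<Rightarrow> 'a::real_normed_vector"
  assumes ac: "abs_continuous_on {a..b} f" and N: "negligible N" and "0 < \<epsilon>"
  obtains U where "open U" "N \<subseteq> U"
    "\<And>p. p tagged_partial_division_of {a..b} \<Longrightarrow> (\<And>x K. (x, K) \<in> p \<Longrightarrow> K \<subseteq> U) \<Longrightarrow>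
        norm (\<Sum>(x, K)\<in>p. f (Sup K) - f (Inf K)) < \<epsilon>"
proof -
  obtain \<delta> where "0 < \<delta>"
    and \<delta>: "\<And>\<D> T. \<D> division_of T \<Longrightarrow> T \<subseteq> {a..b} \<Longrightarrow> (\<Sum>K\<in>\<D>. measure lborel K) < \<delta> \<Longrightarrow>
        (\<Sum>K\<in>\<D>. norm (f (Sup K) - f (Inf K))) < \<epsilon>"
    using ac \<open>0 < \<epsilon>\<close> unfolding abs_continuous_on_def by metis
  obtain U where U: "open U" "N \<subseteq> U" "U - N \<in> lmeasurable" "emeasure lebesgue (U - N) < ennreal \<delta>"
    using sets_lebesgue_outer_open[OF negligible_imp_sets[OF N] \<open>0 < \<delta>\<close>] by metis
  have UN: "U = (U - N) \<union> N" using U by blast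
  have Um: "U \<in> lmeasurable"
    by (subst UN) (intro fmeasurable.Un U(3) negligible_imp_measurable[OF N])
  have "measure lebesgue U \<le> measure lebesgue (U - N) + measure lebesgue N"
    by (subst UN) (intro measure_Un_le fmeasurableD U(3) negligible_imp_sets[OF N])
  also have "\<dots> < \<delta>"
    using U(3,4) \<open>0 < \<delta>\<close> negligible_imp_measure0[OF N]
    by (simp add: emeasure_eq_measure2 ennreal_less_iff)
  finally have Ud: "measure lebesgue U < \<delta>" .
  show thesis
  proof (rule that[OF U(1,2)])
    fix p :: "(real \<times> real set) set"
    assume p: "p tagged_partial_division_of {a..b}" and pU: "\<And>x K. (x, K) \<in> p \<Longrightarrow> K \<subseteq> U"
    let ?T = "\<Union> (snd ` p)"
    note p' = tagged_partial_division_of_Union_self[OF p]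
    have div: "snd ` p division_of ?T"
      by (rule division_of_tagged_division[OF p'])
    have sub: "?T \<subseteq> {a..b}" using tagged_partial_division_ofD(3)[OF p] by fastforce
    have "(\<Sum>K\<in>snd ` p. measure lborel K) = (\<Sum>K\<in>snd ` p. measure lebesgue K)"
    proof (rule sum.cong)
      fix K assume "K \<in> snd ` p"
      then obtain u v where "K = cbox u v" using division_ofD(4)[OF div] by blast
      then show "measure lborel K = measure lebesgue K" by (simp add: measure_completion)
    qed simp
    also have "\<dots> = measure lebesgue ?T" by (rule content_division[OF div])
    also have "\<dots> \<le> measure lebesgue U"
    proof (rule measure_mono_fmeasurable)
      show "?T \<subseteq> U" using pU by fastforce
    qed (simp_all add: fmeasurableD lmeasurable_division[OF div] Um)
    finally have "(\<Sum>K\<in>snd ` p. norm (f (Sup K) - f (Inf K))) < \<epsilon>"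
      using \<delta>[OF div sub] Ud by linarith
    \<comment> \<open>Passing from tagged pairs to intervals needs degenerate intervals to
      contribute 0. The guard at \<open>{}\<close> ensures this there, where \<open>Sup\<close> and
      \<open>Inf\<close> carry no meaning.\<close>
    moreover have "(\<Sum>(x, K)\<in>p. norm (f (Sup K) - f (Inf K)))
        = (\<Sum>(x, K)\<in>p. if K = {} then 0 else norm (f (Sup K) - f (Inf K)))"
      by (intro sum.cong) (auto dest: tagged_partial_division_ofD(2)[OF p])
    moreover have "\<dots> = (\<Sum>K\<in>snd ` p. if K = {} then 0 else norm (f (Sup K) - f (Inf K)))"
    proof (rule sum.over_tagged_division_lemma[OF p'])
      fix u v :: real
      assume "box u v = {}"
      then have "cbox u v = {} \<or> cbox u v = {u}" by auto
      then show "(if cbox u v = {} then 0 else norm (f (Sup (cbox u v)) - f (Inf (cbox u v)))) = 0"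
        by (auto simp del: box_real)
    qed
    moreover have "\<dots> = (\<Sum>K\<in>snd ` p. norm (f (Sup K) - f (Inf K)))"
      using division_ofD(3)[OF div] by (intro sum.cong) auto
    moreover have "norm (\<Sum>(x, K)\<in>p. f (Sup K) - f (Inf K)) \<le> (\<Sum>(x, K)\<in>p. norm (f (Sup K) - f (Inf K)))"
      by (rule order_trans[OF norm_sum]) (auto intro: sum_mono simp: split_def)
    ultimately show "norm (\<Sum>(x, K)\<in>p. f (Sup K) - f (Inf K)) < \<epsilon>" by linarith
  qed
qed

text \<open>Henstock's argument: the gauge is the set \<open>U\<close> of the previous lemma at tags
  in \<open>N\<close>, and a ball of good linear approximation at all other tags. Absolute
  continuity controls the first kind of intervals, the derivative the second.\<close>

lemma fundamental_theorem_of_calculus_abs_continuous: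
  fixes f :: "real \<Rightarrow> 'a::banach"
  assumes ab: "a \<le> b" and ac: "abs_continuous_on {a..b} f" and N: "negligible N"
    and deriv: "\<And>x. x \<in> {a..b} - N \<Longrightarrow> (f has_vector_derivative f' x) (at x within {a..b})"
  shows "(f' has_integral (f b - f a)) {a..b}"
proof (rule has_integral_spike[OF N])
  \<comment> \<open>With value 0 on \<open>N\<close>, tags in \<open>N\<close> contribute only
    increments of \<open>f\<close> to the error.\<close>
  define g where "g x = (if x \<in> N then 0 else f' x)" for x
  show "f' x = g x" if "x \<in> {a..b} - N" for x using that by (simp add: g_def)
  show "(g has_integral (f b - f a)) {a..b}"
    unfolding has_integral_real
  proof (intro allI impI)
    fix \<epsilon> :: real assume "\<epsilon> > 0"
    \<comment> \<open>Off \<open>N\<close> the error is at most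
      \<open>e * (b - a) < \<epsilon> / 2\<close>; the \<open>+ 1\<close> covers
      \<open>a = b\<close>.\<close>
    define e where "e = \<epsilon> / 2 / (b - a + 1)"
    have e: "e > 0" using \<open>\<epsilon> > 0\<close> ab by (simp add: e_def)
    obtain U where U: "open U" "N \<subseteq> U"
      and fU: "\<And>p. p tagged_partial_division_of {a..b} \<Longrightarrow> (\<And>x K. (x, K) \<in> p \<Longrightarrow> K \<subseteq> U) \<Longrightarrow>
        norm (\<Sum>(x, K)\<in>p. f (Sup K) - f (Inf K)) < \<epsilon> / 2"
      by (rule abs_continuous_on_small_tags[OF ac N half_gt_zero[OF \<open>\<epsilon> > 0\<close>]]) blast
    have "\<forall>x. \<exists>d>0. x \<in> {a..b} - N \<longrightarrow>
         (\<forall>y\<in>{a..b}. norm (y-x) < d \<longrightarrow> norm (f y - f x - (y-x) *\<^sub>R f' x) \<le> e * norm (y-x))"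
      using deriv[unfolded has_vector_derivative_def has_derivative_within_alt] e by blast
    then obtain d where d: "\<And>x. 0 < d x"
      "\<And>x y. \<lbrakk>x \<in> {a..b} - N; y \<in> {a..b}; norm (y-x) < d x\<rbrakk>
          \<Longrightarrow> norm (f y - f x - (y-x) *\<^sub>R f' x) \<le> e * norm (y-x)"
      by metis
    define G where "G x = (if x \<in> N then U else ball x (d x))" for x
    show "\<exists>\<gamma>. gauge \<gamma> \<and> (\<forall>\<D>. \<D> tagged_division_of {a..b} \<and> \<gamma> fine \<D> \<longrightarrow>
          norm ((\<Sum>(x, K)\<in>\<D>. measure lborel K *\<^sub>R g x) - (f b - f a)) < \<epsilon>)"
    proof (intro exI[of _ G] conjI allI impI)
      show "gauge G" using U d(1) by (auto simp: gauge_def G_def)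
      fix p assume "p tagged_division_of {a..b} \<and> G fine p"
      then have p: "p tagged_division_of {a..b}" and fine: "G fine p" by auto
      note pD = tagged_division_ofD[OF p]
      let ?P = "p \<inter> {(x, K). x \<in> N}" and ?Q = "p - {(x, K). x \<in> N}"
      have pP: "?P tagged_partial_division_of {a..b}"
        using p unfolding tagged_division_of_def by (blast intro: tagged_partial_division_subset)
      have 1: "norm (\<Sum>(x, K)\<in>?P. f (Sup K) - f (Inf K)) < \<epsilon> / 2"
      proof (rule fU[OF pP])
        fix x K assume "(x, K) \<in> ?P"
        then show "K \<subseteq> U" using fineD[OF fine, of x K] by (auto simp: G_def)
      qed
      have "norm (\<Sum>(x, K)\<in>?Q. f (Sup K) - f (Inf K) - measure lborel K *\<^sub>R g x)
          \<le> (\<Sum>(x, K)\<in>?Q. e * (Sup K - Inf K))"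
      proof (rule sum_norm_le)
        fix xK assume "xK \<in> ?Q"
        then obtain x K where eq: "xK = (x, K)" and xK: "(x, K) \<in> p" and "x \<notin> N"
          by (cases xK) auto
        then obtain u v where K: "K = {u..v}" and "x \<in> K" and sub: "K \<subseteq> {a..b}"
          using pD(2-4)[of x K] by (metis box_real(2))
        have "u \<le> v" using \<open>x \<in> K\<close> K by auto
        have "K \<subseteq> ball x (d x)" using fineD[OF fine xK] \<open>x \<notin> N\<close> by (simp add: G_def)
        then have uv: "u \<in> K" "v \<in> K" "\<bar>u - x\<bar> < d x" "\<bar>v - x\<bar> < d x"
          using \<open>u \<le> v\<close> by (auto simp: K subset_iff dist_real_def)
        have x: "x \<in> {a..b} - N" using \<open>x \<in> K\<close> sub \<open>x \<notin> N\<close> by blast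
        have "f v - f u - (v - u) *\<^sub>R f' x
            = (f v - f x - (v - x) *\<^sub>R f' x) - (f u - f x - (u - x) *\<^sub>R f' x)"
          by (simp add: algebra_simps)
        then have "norm (f v - f u - (v - u) *\<^sub>R f' x)
            \<le> norm (f v - f x - (v - x) *\<^sub>R f' x) + norm (f u - f x - (u - x) *\<^sub>R f' x)"
          by (metis norm_triangle_ineq4)
        also have "\<dots> \<le> e * norm (v - x) + e * norm (u - x)"
          using d(2)[OF x, of u] d(2)[OF x, of v] uv sub by (intro add_mono) auto
        also have "\<dots> = e * (v - u)"
          using \<open>x \<in> K\<close> by (simp add: K algebra_simps)
        finally show "norm (case xK of (x, K) \<Rightarrow> f (Sup K) - f (Inf K) - measure lborel K *\<^sub>R g x)
            \<le> (case xK of (x, K) \<Rightarrow> e * (Sup K - Inf K))"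
          using \<open>u \<le> v\<close> \<open>x \<notin> N\<close> by (simp add: eq K g_def)
      qed
      also have "\<dots> \<le> (\<Sum>(x, K)\<in>p. e * (Sup K - Inf K))"
      proof (rule sum_mono2)
        fix xK assume "xK \<in> p - ?Q"
        then obtain x u v where "xK = (x, {u..v})" "x \<in> {u..v}"
          using pD(2,4) by (metis DiffE box_real(2) surj_pair)
        then show "0 \<le> (case xK of (x, K) \<Rightarrow> e * (Sup K - Inf K))" using e by auto
      qed (use pD(1) in auto)
      also have "\<dots> = e * (b - a)"
        using additive_tagged_division_1[OF ab p, of "\<lambda>x. x"]
        by (simp add: split_def flip: sum_distrib_left)
      also have "\<dots> < \<epsilon> / 2" using \<open>\<epsilon> > 0\<close> ab by (simp add: e_def field_simps)
      finally have 2: "norm (\<Sum>(x, K)\<in>?Q. f (Sup K) - f (Inf K) - measure lborel K *\<^sub>R g x) < \<epsilon> / 2" .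
      have "f b - f a - (\<Sum>(x, K)\<in>p. measure lborel K *\<^sub>R g x)
          = (\<Sum>(x, K)\<in>p. f (Sup K) - f (Inf K) - measure lborel K *\<^sub>R g x)"
        using additive_tagged_division_1[OF ab p, of f] by (simp add: split_def sum_subtractf)
      also have "\<dots> = (\<Sum>(x, K)\<in>?P. f (Sup K) - f (Inf K) - measure lborel K *\<^sub>R g x)
          + (\<Sum>(x, K)\<in>?Q. f (Sup K) - f (Inf K) - measure lborel K *\<^sub>R g x)"
        using pD(1) by (intro sum.Int_Diff)
      also have "(\<Sum>(x, K)\<in>?P. f (Sup K) - f (Inf K) - measure lborel K *\<^sub>R g x)
          = (\<Sum>(x, K)\<in>?P. f (Sup K) - f (Inf K))"
        by (intro sum.cong) (auto simp: g_def)
      finally show "norm ((\<Sum>(x, K)\<in>p. measure lborel K *\<^sub>R g x) - (f b - f a)) < \<epsilon>"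
        using norm_triangle_lt[of "\<Sum>(x, K)\<in>?P. f (Sup K) - f (Inf K)"] 1 2
        by (simp add: norm_minus_commute)
    qed
  qed
qed

section \<open>The size of the Carnot-Caratheodory distance\<close>

definition hgap :: "heis \<Rightarrow> heis \<Rightarrow> real" where
  "hgap p q = \<bar>fst q - fst p\<bar> + \<bar>fst (snd q) - fst (snd p)\<bar>"

text \<open>The \<open>z\<close>-coordinate of \<open>p\<^sup>-\<^sup>1 q\<close>.\<close>
definition vgap :: "heis \<Rightarrow> heis \<Rightarrow> real" where
  "vgap p q = snd (snd q) - snd (snd p) - (fst p * fst (snd q) - fst (snd p) * fst q) / 2"

lemma field_components [simp]:
  "fst (fieldX p) = 1" "fst (snd (fieldX p)) = 0" "snd (snd (fieldX p)) = - fst (snd p) / 2"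
  "fst (fieldY p) = 0" "fst (snd (fieldY p)) = 1" "snd (snd (fieldY p)) = fst p / 2"
  by (cases p; simp)+

text \<open>Each horizontal coordinate moves at most as fast as the curve. The vertical coordinate
  relative to the starting point has derivative half the wedge of displacement and velocity, hence
  at most \<open>l\<close> times the speed; integrating gives \<open>l\<^sup>2\<close>.\<close>

lemma horizontal_curve_length_bounds:
  assumes "horizontal_curve \<gamma> a b"
    and len: "((\<lambda>t. sqrt ((a t)\<^sup>2 + (b t)\<^sup>2)) has_integral l) {0..1}"
  shows "hgap (\<gamma> 0) (\<gamma> 1) \<le> 2 * l" and "\<bar>vgap (\<gamma> 0) (\<gamma> 1)\<bar> \<le> l\<^sup>2"
proof -
  define s where "s t = sqrt ((a t)\<^sup>2 + (b t)\<^sup>2)" for t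
  define v where "v t = a t *\<^sub>R fieldX (\<gamma> t) + b t *\<^sub>R fieldY (\<gamma> t)" for t
  have ac: "abs_continuous_on {0..1} \<gamma>"
    and "AE t in lebesgue_on {0..1}. (\<gamma> has_vector_derivative v t) (at t within {0..1})"
    using assms(1) by (simp_all add: horizontal_curve_def v_def)
  then have "AE t in lebesgue. t \<in> {0..1} \<longrightarrow> (\<gamma> has_vector_derivative v t) (at t within {0..1})"
    by (subst (asm) AE_restrict_space_iff) auto
  then obtain N where N: "negligible N"
    and der: "\<And>t. t \<in> {0..1} - N \<Longrightarrow> (\<gamma> has_vector_derivative v t) (at t within {0..1})"
    unfolding eventually_ae_filter_negligible by blast
  have v_int: "(v has_integral (\<gamma> t - \<gamma> 0)) {0..t}" if "t \<in> {0..1}" for t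
  proof (rule fundamental_theorem_of_calculus_abs_continuous[OF _ _ N])
    show "abs_continuous_on {0..t} \<gamma>"
      using abs_continuous_on_subset[OF ac] that by auto
    fix x assume "x \<in> {0..t} - N"
    then show "(\<gamma> has_vector_derivative v x) (at x within {0..t})"
      using that by (intro has_vector_derivative_within_subset[OF der]) auto
  qed (use that in auto)
  have s_int: "s integrable_on {0..t}" if "t \<in> {0..1}" for t
    using integrable_on_subinterval[OF has_integral_integrable[OF len], of 0 t] that
    by (simp add: s_def[abs_def])
  have len': "(s has_integral l) {0..1}" using len by (simp add: s_def[abs_def])
  have s0: "0 \<le> s t" for t by (simp add: s_def)
  have s_le: "integral {0..t} s \<le> l" if "t \<in> {0..1}" for t
    using integral_subset_le[of "{0..t}" "{0..1}" s] s_int[of t] s_int[of 1] s0 that integral_unique[OF len']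
    by auto
  have ab: "\<bar>a t\<bar> \<le> s t" "\<bar>b t\<bar> \<le> s t" for t
    by (simp_all add: s_def real_le_rsqrt)
  have bd: "\<bar>i\<bar> \<le> l" if "(c has_integral i) {0..t}" "\<And>u. \<bar>c u\<bar> \<le> s u" "t \<in> {0..1}" for c i t
    using integral_norm_bound_integral[of c "{0..t}" s] that s_int[of t] s_le[of t]
    by (auto simp: has_integral_iff)
  have X: "\<bar>fst (\<gamma> t) - fst (\<gamma> 0)\<bar> \<le> l" if "t \<in> {0..1}" for t
    using has_integral_linear[OF v_int[OF that] bounded_linear_fst] that
    by (intro bd[of a _ t]) (auto simp: o_def v_def ab)
  have Y: "\<bar>fst (snd (\<gamma> t)) - fst (snd (\<gamma> 0))\<bar> \<le> l" if "t \<in> {0..1}" for t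
    using has_integral_linear[OF v_int[OF that] bounded_linear_compose[OF bounded_linear_fst bounded_linear_snd]] that
    by (intro bd[of b _ t]) (auto simp: o_def v_def ab)
  show "hgap (\<gamma> 0) (\<gamma> 1) \<le> 2 * l"
    using X[of 1] Y[of 1] by (simp add: hgap_def)
  \<comment> \<open>With the starting point frozen, \<open>vgap (\<gamma> 0)\<close> is affine;
    \<open>L\<close> is its linear part and so commutes with the integral.\<close>
  define L where "L p = snd (snd p) - (fst (\<gamma> 0) * fst (snd p) - fst (snd (\<gamma> 0)) * fst p) / 2" for p :: heis
  have bL: "bounded_linear L"
    unfolding L_def
    by (intro bounded_linear_intros bounded_linear_compose[OF bounded_linear_fst bounded_linear_snd]
        bounded_linear_compose[OF bounded_linear_snd bounded_linear_snd]
        bounded_linear_divide[THEN bounded_linear_compose])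
  have "L (\<gamma> 1 - \<gamma> 0) = vgap (\<gamma> 0) (\<gamma> 1)"
    by (simp add: L_def vgap_def algebra_simps)
  then have V: "((L \<circ> v) has_integral vgap (\<gamma> 0) (\<gamma> 1)) {0..1}"
    using has_integral_linear[OF v_int[of 1] bL] by simp
  have Lv: "\<bar>L (v t)\<bar> \<le> l * s t" if "t \<in> {0..1}" for t
  proof -
    have "L (v t) = ((fst (\<gamma> t) - fst (\<gamma> 0)) * b t - (fst (snd (\<gamma> t)) - fst (snd (\<gamma> 0))) * a t) / 2"
      by (simp add: L_def v_def field_simps)
    moreover have "\<bar>(fst (\<gamma> t) - fst (\<gamma> 0)) * b t\<bar> \<le> l * s t"
      unfolding abs_mult using X[OF that] ab by (intro mult_mono) (auto intro: order_trans[OF abs_ge_zero])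
    moreover have "\<bar>(fst (snd (\<gamma> t)) - fst (snd (\<gamma> 0))) * a t\<bar> \<le> l * s t"
      unfolding abs_mult using Y[OF that] ab by (intro mult_mono) (auto intro: order_trans[OF abs_ge_zero])
    moreover have "\<bar>(P - Q) / 2\<bar> \<le> c" if "\<bar>P\<bar> \<le> c" "\<bar>Q\<bar> \<le> c" for P Q c :: real
      using that by (auto simp: abs_le_iff)
    ultimately show ?thesis by presburger
  qed
  have "norm (integral {0..1} (L \<circ> v)) \<le> integral {0..1} (\<lambda>t. l * s t)"
    using V Lv by (intro integral_norm_bound_integral)
      (auto simp: has_integral_integrable intro!: integrable_on_mult_right s_int)
  then show "\<bar>vgap (\<gamma> 0) (\<gamma> 1)\<bar> \<le> l\<^sup>2"
    using integral_unique[OF V] integral_unique[OF len'] by (simp add: power2_eq_square)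
qed

section \<open>Explicit horizontal curves and the two-sided bound for \<open>d_cc\<close>\<close>

lemma C1_imp_abs_continuous_on:
  fixes f :: "real \<Rightarrow> 'a::real_normed_vector"
  assumes der: "\<And>t. t \<in> {a..b} \<Longrightarrow> (f has_vector_derivative f' t) (at t within {a..b})"
    and cont: "continuous_on {a..b} f'"
  shows "abs_continuous_on {a..b} f"
proof -
  obtain B where "B > 0" and B: "\<And>t. t \<in> {a..b} \<Longrightarrow> norm (f' t) \<le> B"
    using compact_imp_bounded[OF compact_continuous_image[OF cont compact_Icc]]
    by (auto simp: bounded_pos)
  have lip: "norm (f v - f u) \<le> B * (v - u)" if "u \<le> v" "u \<in> {a..b}" "v \<in> {a..b}" for u v
  proof -
    have "norm (f v - f u) \<le> B * norm (v - u)"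
    proof (rule differentiable_bound[of "{a..b}" f "\<lambda>x h. h *\<^sub>R f' x"])
      show "onorm (\<lambda>h. h *\<^sub>R f' x) \<le> B" if "x \<in> {a..b}" for x
        using B[OF that] by (simp add: onorm_scaleR_left onorm_id)
    qed (use der that in \<open>auto simp: has_vector_derivative_def\<close>)
    then show ?thesis using that by simp
  qed
  show ?thesis
    unfolding abs_continuous_on_def
  proof (intro allI impI)
    fix \<epsilon> :: real assume "\<epsilon> > 0"
    show "\<exists>\<delta>>0. \<forall>\<D> T. \<D> division_of T \<and> T \<subseteq> {a..b} \<and> (\<Sum>K\<in>\<D>. measure lborel K) < \<delta> \<longrightarrow>
        (\<Sum>K\<in>\<D>. norm (f (Sup K) - f (Inf K))) < \<epsilon>"
    proof (intro exI[of _ "\<epsilon> / B"] conjI allI impI)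
      fix \<D> T assume A: "\<D> division_of T \<and> T \<subseteq> {a..b} \<and> (\<Sum>K\<in>\<D>. measure lborel K) < \<epsilon> / B"
      then have div: "\<D> division_of T" and T: "T \<subseteq> {a..b}" by auto
      have "(\<Sum>K\<in>\<D>. norm (f (Sup K) - f (Inf K))) \<le> (\<Sum>K\<in>\<D>. B * measure lborel K)"
      proof (rule sum_mono)
        fix K assume K: "K \<in> \<D>"
        then obtain u v where uv: "K = {u..v}" "u \<le> v"
          using division_ofD(3,4)[OF div K] by fastforce
        moreover have "K \<subseteq> {a..b}" using division_ofD(2)[OF div K] T by blast
        ultimately show "norm (f (Sup K) - f (Inf K)) \<le> B * measure lborel K"
          using lip[of u v] by auto
      qed
      also have "\<dots> < \<epsilon>"
        using A \<open>B > 0\<close> by (simp add: field_simps flip: sum_distrib_left)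
      finally show "(\<Sum>K\<in>\<D>. norm (f (Sup K) - f (Inf K))) < \<epsilon>" .
    qed (use \<open>B > 0\<close> \<open>\<epsilon> > 0\<close> in simp)
  qed
qed

text \<open>The planar curve adds to the segment a loop built from the polynomials \<open>t (1 - t) (1 - 2 t)\<close>
  and \<open>t (1 - t) (1 - 5 t (1 - t))\<close>: both vanish at the endpoints and have mean zero, so the loop
  does not interact with the segment and encloses area \<open>- A B / 70\<close>.\<close>
lemma ex_short_horizontal_curve:
  obtains \<gamma> a b l where "horizontal_curve \<gamma> a b" "\<gamma> 0 = p" "\<gamma> 1 = q"
    "((\<lambda>t. sqrt ((a t)\<^sup>2 + (b t)\<^sup>2)) has_integral l) {0..1}"
    "l \<le> 4500 * (hgap p q + sqrt \<bar>vgap p q\<bar>)"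
proof -
  obtain x0 y0 z0 where p: "p = (x0, y0, z0)" by (metis surj_pair)
  obtain x1 y1 z1 where q: "q = (x1, y1, z1)" by (metis surj_pair)
  define X Y Z where "X = x1 - x0" and "Y = y1 - y0" and "Z = vgap p q"
  \<comment> \<open>The loop encloses \<open>- A * B / 70 = Z\<close>. Both amplitudes are multiples
    of \<open>sqrt \<bar>Z\<bar>\<close>, so its length is too; \<open>sgn Z\<close> chooses the
    orientation.\<close>
  define A B where "A = sqrt \<bar>Z\<bar>" and "B = - 70 * sgn Z * sqrt \<bar>Z\<bar>"
  have AB: "A * B = - 70 * Z"
  proof -
    have "A * B = - 70 * (sgn Z * (sqrt \<bar>Z\<bar> * sqrt \<bar>Z\<bar>))" by (simp add: A_def B_def)
    then show ?thesis by (simp add: sgn_mult_abs del: mult_minus_left)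
  qed
  have z1: "z1 = z0 + Z + (x0 * y1 - y0 * x1) / 2"
    by (simp add: Z_def p q vgap_def)
  define u u' where "u t = X * t + A * (t - 3 * t^2 + 2 * t^3)"
    and "u' t = X + A * (1 - 6 * t + 6 * t^2)" for t
  define v v' where "v t = Y * t + B * (t - 6 * t^2 + 10 * t^3 - 5 * t^4)"
    and "v' t = Y + B * (1 - 12 * t + 30 * t^2 - 20 * t^3)" for t
  \<comment> \<open>\<open>w\<close> is the area swept by \<open>(u, v)\<close>, the antiderivative
    of \<open>(u * v' - v * u') / 2\<close> vanishing at 0. Then \<open>\<gamma>\<close> is the left
    translate by \<open>p\<close> of the horizontal lift \<open>(u, v, w)\<close>.\<close>
  define w where "w t = (X * B * (- 2 * t^3 + 5 * t^4 - 3 * t^5) + A * Y * (t^3 - t^4)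
      + A * B * (- (t^3) + 4 * t^4 - 33 / 5 * t^5 + 5 * t^6 - 10 / 7 * t^7)) / 2" for t
  define \<gamma> where "\<gamma> t = (x0 + u t, y0 + v t, z0 + w t + (x0 * v t - y0 * u t) / 2)" for t
  define \<gamma>' where "\<gamma>' t = u' t *\<^sub>R fieldX (\<gamma> t) + v' t *\<^sub>R fieldY (\<gamma> t)" for t
  have u: "(u has_real_derivative u' t) (at t)" for t
    unfolding u_def u'_def by (auto intro!: derivative_eq_intros simp: algebra_simps)
  have v: "(v has_real_derivative v' t) (at t)" for t
    unfolding v_def v'_def by (auto intro!: derivative_eq_intros simp: algebra_simps)
  have w: "(w has_real_derivative (u t * v' t - v t * u' t) / 2) (at t)" for t
    unfolding w_def u_def v_def u'_def v'_def
    by (auto intro!: derivative_eq_intros simp: field_simps) algebra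
  have \<gamma>': "\<gamma>' t = (u' t, v' t, (u t * v' t - v t * u' t) / 2 + (x0 * v' t - y0 * u' t) / 2)" for t
    by (simp add: \<gamma>'_def \<gamma>_def field_simps)
  have der: "(\<gamma> has_vector_derivative \<gamma>' t) (at t within S)" for t S
    unfolding \<gamma>_def \<gamma>'
    using u[of t] v[of t] w[of t]
    by (auto intro!: derivative_eq_intros has_vector_derivative_Pair
        simp: has_real_derivative_iff_has_vector_derivative intro: has_vector_derivative_at_within)
  have cu: "continuous_on S u'" "continuous_on S v'" "continuous_on S u" "continuous_on S v" for S
    unfolding u'_def v'_def u_def v_def by (intro continuous_intros)+
  have "continuous_on {0..1} \<gamma>'"
    unfolding \<gamma>' by (intro continuous_intros cu) auto
  then have hor: "horizontal_curve \<gamma> u' v'"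
    unfolding horizontal_curve_def
    using der by (auto intro!: C1_imp_abs_continuous_on simp flip: \<gamma>'_def)
  have ends: "\<gamma> 0 = p" "\<gamma> 1 = q"
    using AB by (auto simp: \<gamma>_def u_def v_def w_def p q X_def Y_def z1 algebra_simps)
  have "(\<lambda>t. sqrt ((u' t)\<^sup>2 + (v' t)\<^sup>2)) integrable_on {0..1}"
    by (intro integrable_continuous_real continuous_intros cu)
  then obtain l where l: "((\<lambda>t. sqrt ((u' t)\<^sup>2 + (v' t)\<^sup>2)) has_integral l) {0..1}"
    by (auto simp: integrable_on_def)
  \<comment> \<open>The derivative polynomials are bounded by \<open>13 = 1 + 6 + 6\<close> and
    \<open>63 = 1 + 12 + 30 + 20\<close>. With the amplitude 70 of \<open>B\<close> the loop costs
    \<open>13 + 70 * 63 = 4423 \<le> 4500\<close> times \<open>sqrt \<bar>Z\<bar>\<close>.\<close>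
  define M where "M = \<bar>X\<bar> + \<bar>Y\<bar> + 4500 * sqrt \<bar>Z\<bar>"
  have "l \<le> M"
  proof (rule has_integral_le[OF l])
    show "((\<lambda>t. M) has_integral M) {0..1::real}"
      using has_integral_const_real[of M 0 1] by simp
    fix t :: real assume t: "t \<in> {0..1}"
    then have t1: "0 \<le> t" "t \<le> 1" "0 \<le> t^2" "t^2 \<le> 1" "0 \<le> t^3" "t^3 \<le> 1"
      by (auto simp: power_le_one)
    then have bds: "\<bar>1 - 6 * t + 6 * t^2\<bar> \<le> 13" "\<bar>1 - 12 * t + 30 * t^2 - 20 * t^3\<bar> \<le> 63"
      unfolding abs_le_iff by linarith+
    have "\<bar>u' t - X\<bar> \<le> sqrt \<bar>Z\<bar> * 13"
      unfolding u'_def add_diff_cancel_left' abs_mult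
      using bds by (intro mult_mono) (auto simp: A_def)
    moreover have "\<bar>v' t - Y\<bar> \<le> (70 * sqrt \<bar>Z\<bar>) * 63"
      unfolding v'_def add_diff_cancel_left' abs_mult
      using bds by (intro mult_mono) (auto simp: B_def abs_mult abs_sgn_eq)
    moreover have "sqrt ((u' t)\<^sup>2 + (v' t)\<^sup>2) \<le> \<bar>u' t\<bar> + \<bar>v' t\<bar>"
      by (rule sqrt_sum_squares_le_sum_abs)
    ultimately show "sqrt ((u' t)\<^sup>2 + (v' t)\<^sup>2) \<le> M"
      unfolding M_def using real_sqrt_ge_zero[of "\<bar>Z\<bar>"] by linarith
  qed
  also have "\<dots> \<le> 4500 * (hgap p q + sqrt \<bar>vgap p q\<bar>)"
    by (simp add: M_def hgap_def X_def Y_def Z_def p q)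
  finally show thesis
    using that[OF hor ends l] by blast
qed

lemma d_cc_bounds:
  "hgap p q + sqrt \<bar>vgap p q\<bar> \<le> 3 * d_cc p q"
  "d_cc p q \<le> 4500 * (hgap p q + sqrt \<bar>vgap p q\<bar>)"
proof -
  let ?S = "{l. \<exists>\<gamma> a b. horizontal_curve \<gamma> a b \<and> \<gamma> 0 = p \<and> \<gamma> 1 = q \<and>
                        ((\<lambda>t. sqrt ((a t)\<^sup>2 + (b t)\<^sup>2)) has_integral l) {0..1}}"
  obtain \<gamma> a b l where "horizontal_curve \<gamma> a b" "\<gamma> 0 = p" "\<gamma> 1 = q"
    "((\<lambda>t. sqrt ((a t)\<^sup>2 + (b t)\<^sup>2)) has_integral l) {0..1}"
    and l: "l \<le> 4500 * (hgap p q + sqrt \<bar>vgap p q\<bar>)"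
    by (rule ex_short_horizontal_curve)
  then have lS: "l \<in> ?S" by blast
  \<comment> \<open>The factor 3 is \<open>2 + 1\<close>: \<open>hgap\<close> is at most
    \<open>2 * m\<close> and the square root at most \<open>m\<close>.\<close>
  have low: "(hgap p q + sqrt \<bar>vgap p q\<bar>) / 3 \<le> m" if m: "m \<in> ?S" for m
  proof -
    obtain \<gamma> a b where \<gamma>: "horizontal_curve \<gamma> a b" "\<gamma> 0 = p" "\<gamma> 1 = q"
      and m: "((\<lambda>t. sqrt ((a t)\<^sup>2 + (b t)\<^sup>2)) has_integral m) {0..1}"
      using m by blast
    have "0 \<le> m" by (rule has_integral_nonneg[OF m]) simp
    then have "sqrt \<bar>vgap p q\<bar> \<le> m"
      using horizontal_curve_length_bounds(2)[OF \<gamma>(1) m] by (simp add: \<gamma> real_le_lsqrt)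
    then show ?thesis
      using horizontal_curve_length_bounds(1)[OF \<gamma>(1) m] by (simp add: \<gamma>)
  qed
  have "(hgap p q + sqrt \<bar>vgap p q\<bar>) / 3 \<le> d_cc p q"
    unfolding d_cc_def using lS low by (intro cInf_greatest) blast+
  then show "hgap p q + sqrt \<bar>vgap p q\<bar> \<le> 3 * d_cc p q" by simp
  have "bdd_below ?S" by (rule bdd_belowI[OF low])
  then show "d_cc p q \<le> 4500 * (hgap p q + sqrt \<bar>vgap p q\<bar>)"
    unfolding d_cc_def using cInf_lower[OF lS] l by linarith
qed

section \<open>Distances with an oscillating vertical gauge\<close>

text \<open>Here \<open>s\<close> is the logarithm of the scale. The constant 8 keeps the lower
  bound 5 well above the Lipschitz constant \<open>5 / 2\<close> in \<open>s\<close>, which is the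
  source of superadditivity.\<close>

definition profile :: "(real \<Rightarrow> real) \<Rightarrow> real \<Rightarrow> real \<Rightarrow> real" where
  "profile w s x = 8 + sin (sqrt 2 * s) + (1 - cos s) * w (x * exp (- 2 * pi * of_int \<lfloor>s / (2 * pi)\<rfloor>))"

definition growth :: "(real \<Rightarrow> real) \<Rightarrow> real \<Rightarrow> real \<Rightarrow> real" where
  "growth w a x = a\<^sup>2 * profile w (ln a) x"

definition vertical :: "(real \<Rightarrow> real) \<Rightarrow> real \<Rightarrow> real \<Rightarrow> real" where
  "vertical w u x = (THE a. 0 \<le> a \<and> growth w a x = u)"

text \<open>The base point enters through \<open>fst p + fst q\<close>, which keeps the distance
  symmetric. In the horizontal factor, \<open>2 * exp (2 * pi)\<close> is the Lipschitz constant of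
  \<open>growth\<close> in the base point, and the 1 pays for the area term of the group
  law.\<close>

definition wave_dist :: "(real \<Rightarrow> real) \<Rightarrow> heis \<Rightarrow> heis \<Rightarrow> real" where
  "wave_dist w p q = max ((2 * exp (2 * pi) + 1) * hgap p q) (vertical w \<bar>vgap p q\<bar> (fst p + fst q))"

section \<open>Bounds and Lipschitz estimates for the profile\<close>

lemma abs_sin_diff_le: "\<bar>sin x - sin y\<bar> \<le> \<bar>x - y\<bar>" for x y :: real
proof -
  have "norm (sin x - sin y) \<le> 1 * norm (x - y)"
    by (rule field_differentiable_bound[of UNIV sin cos])
      (auto intro: DERIV_subset[OF DERIV_sin])
  then show ?thesis by simp
qed

lemma abs_cos_diff_le: "\<bar>cos x - cos y\<bar> \<le> \<bar>x - y\<bar>" for x y :: real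
  using abs_sin_diff_le[of "x + pi / 2" "y + pi / 2"] by (simp add: sin_add)

locale wave =
  fixes w :: "real \<Rightarrow> real"
  assumes wave_bound: "\<bar>w x\<bar> \<le> 1"
    and wave_lipschitz: "\<bar>w x - w y\<bar> \<le> \<bar>x - y\<bar>"
begin

lemma profile_bounds: "5 \<le> profile w s x" "profile w s x \<le> 11"
proof -
  let ?c = "w (x * exp (- 2 * pi * of_int \<lfloor>s / (2 * pi)\<rfloor>))"
  have "\<bar>(1 - cos s) * ?c\<bar> \<le> 2 * 1"
    unfolding abs_mult using cos_ge_minus_one[of s] cos_le_one[of s] wave_bound
    by (intro mult_mono) auto
  then show "5 \<le> profile w s x" "profile w s x \<le> 11"
    unfolding profile_def
    using sin_ge_minus_one[of "sqrt 2 * s"] sin_le_one[of "sqrt 2 * s"] by linarith+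
qed

text \<open>The factor \<open>1 - cos s\<close> vanishes where \<open>\<lfloor>s / (2 \<pi>)\<rfloor>\<close> jumps.\<close>
lemma modulation_lipschitz:
  assumes "s \<le> t"
  shows "\<bar>(1 - cos t) * w (x * exp (- 2 * pi * of_int \<lfloor>t / (2 * pi)\<rfloor>))
        - (1 - cos s) * w (x * exp (- 2 * pi * of_int \<lfloor>s / (2 * pi)\<rfloor>))\<bar> \<le> t - s"
    (is "\<bar>_ * ?wt - _ * ?ws\<bar> \<le> _")
proof (cases "\<lfloor>t / (2 * pi)\<rfloor> = \<lfloor>s / (2 * pi)\<rfloor>")
  case True
  have "\<bar>(1 - cos t) * ?wt - (1 - cos s) * ?ws\<bar> = \<bar>cos t - cos s\<bar> * \<bar>?wt\<bar>"
    using True by (simp add: abs_mult abs_minus_commute flip: left_diff_distrib)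
  also have "\<dots> \<le> \<bar>t - s\<bar> * 1"
    using wave_bound abs_cos_diff_le by (intro mult_mono) auto
  finally show ?thesis using assms by simp
next
  case False
  \<comment> \<open>\<open>m\<close> is the last jump before \<open>t\<close>. There
    \<open>cos m = 1\<close>, so the two modulations are at most \<open>t - m\<close> and
    \<open>m - s\<close>, which add up to \<open>t - s\<close>.\<close>
  define m :: real where "m = 2 * pi * of_int \<lfloor>t / (2 * pi)\<rfloor>"
  have "\<lfloor>s / (2 * pi)\<rfloor> \<le> \<lfloor>t / (2 * pi)\<rfloor>"
    using assms by (intro floor_mono divide_right_mono) auto
  with False have "s / (2 * pi) < of_int \<lfloor>t / (2 * pi)\<rfloor>" by linarith
  then have "s < m" by (simp add: m_def field_simps)
  have "of_int \<lfloor>t / (2 * pi)\<rfloor> * (2 * pi) \<le> t"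
    by (subst pos_le_divide_eq[symmetric]) auto
  then have "m \<le> t" by (simp only: m_def mult_ac)
  have "cos m = 1" unfolding m_def by (rule cos_int_2pin)
  have small: "\<bar>(1 - cos a) * w b\<bar> \<le> \<bar>a - m\<bar>" for a b
  proof -
    have "\<bar>(1 - cos a) * w b\<bar> \<le> \<bar>1 - cos a\<bar> * 1"
      unfolding abs_mult using wave_bound by (intro mult_left_mono) auto
    also have "\<dots> \<le> \<bar>a - m\<bar>"
      using abs_cos_diff_le[of a m] \<open>cos m = 1\<close> by (simp add: abs_minus_commute)
    finally show ?thesis .
  qed
  show ?thesis
    using small[of t "x * exp (- 2 * pi * of_int \<lfloor>t / (2 * pi)\<rfloor>)"]
      small[of s "x * exp (- 2 * pi * of_int \<lfloor>s / (2 * pi)\<rfloor>)"] \<open>s < m\<close> \<open>m \<le> t\<close>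
    by linarith
qed

text \<open>\<open>5 / 2\<close> is \<open>3 / 2\<close> for the sine, as
  \<open>sqrt 2 \<le> 3 / 2\<close>, plus 1 for the modulation.\<close>

lemma profile_lipschitz:
  assumes "s \<le> t"
  shows "\<bar>profile w t x - profile w s x\<bar> \<le> 5 / 2 * (t - s)"
proof -
  have "sqrt 2 \<le> 3 / 2" by (rule real_le_lsqrt) (auto simp: power2_eq_square)
  have "\<bar>sin (sqrt 2 * t) - sin (sqrt 2 * s)\<bar> \<le> sqrt 2 * (t - s)"
    using abs_sin_diff_le[of "sqrt 2 * t" "sqrt 2 * s"] assms
    by (simp add: abs_mult flip: right_diff_distrib)
  also have "\<dots> \<le> 3 / 2 * (t - s)"
    using \<open>sqrt 2 \<le> 3 / 2\<close> assms by (intro mult_right_mono) auto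
  finally have *: "\<bar>sin (sqrt 2 * t) - sin (sqrt 2 * s)\<bar> \<le> 3 / 2 * (t - s)" .
  have "\<bar>(8 + a + b) - (8 + c + d)\<bar> \<le> 5 / 2 * h" if "\<bar>a - c\<bar> \<le> 3 / 2 * h" "\<bar>b - d\<bar> \<le> h"
    for a b c d h :: real
    using that by linarith
  then show ?thesis
    unfolding profile_def using * modulation_lipschitz[OF assms] by blast
qed

lemma profile_lipschitz_abs: "\<bar>profile w t x - profile w s x\<bar> \<le> 5 / 2 * \<bar>t - s\<bar>"
  using profile_lipschitz[of s t x] profile_lipschitz[of t s x]
  by (cases "s \<le> t") (auto simp: abs_minus_commute)

text \<open>Since \<open>a * (ln b - ln a) \<le> b - a\<close>, the profile can drop by at most
  \<open>5 / 2 * (b - a)\<close> after multiplication by \<open>a\<close>, while its lower bound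
  gains \<open>5 * (b - a)\<close>.\<close>

lemma profile_increment:
  assumes "0 < a" "a \<le> b"
  shows "5 / 2 * (b - a) \<le> b * profile w (ln b) x - a * profile w (ln a) x"
proof -
  have "0 \<le> ln b - ln a" using assms by simp
  have "ln b - ln a = ln (b / a)" using assms by (simp add: ln_div)
  also have "\<dots> \<le> b / a - 1" using assms by (intro ln_le_minus_one) auto
  finally have "a * (ln b - ln a) \<le> a * (b / a - 1)"
    using assms by (intro mult_left_mono) auto
  then have "a * (ln b - ln a) \<le> b - a" using assms by (simp add: right_diff_distrib)
  moreover have "a * (profile w (ln a) x - profile w (ln b) x) \<le> a * (5 / 2 * (ln b - ln a))"
  proof (rule mult_left_mono)
    show "profile w (ln a) x - profile w (ln b) x \<le> 5 / 2 * (ln b - ln a)"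
      using profile_lipschitz_abs[of "ln b" x "ln a"] \<open>0 \<le> ln b - ln a\<close> by linarith
  qed (use assms in simp)
  moreover have "(b - a) * 5 \<le> (b - a) * profile w (ln b) x"
    using assms profile_bounds(1)[of "ln b" x] by (intro mult_left_mono) auto
  ultimately show ?thesis unfolding ring_distribs by linarith
qed

section \<open>Monotonicity, superadditivity and base-point dependence of
  \<open>growth\<close>\<close>

lemma growth_bounds: "5 * a\<^sup>2 \<le> growth w a x" "growth w a x \<le> 11 * a\<^sup>2"
  unfolding growth_def using profile_bounds[of "ln a" x]
  by (simp_all add: mult.commute[of "a\<^sup>2"] mult_right_mono)

lemma growth_zero [simp]: "growth w 0 x = 0"
  by (simp add: growth_def)

text \<open>With \<open>P\<close> the profile, the increment is
  \<open>b * (b - a) * P b + a * (b * P b - a * P a)\<close>; the last term is nonnegative by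
  \<open>profile_increment\<close>.\<close>

lemma growth_increment:
  assumes "0 \<le> a" "a \<le> b"
  shows "5 * b * (b - a) \<le> growth w b x - growth w a x"
proof (cases "a = 0")
  case True
  then show ?thesis using growth_bounds(1)[of b x] by (simp add: power2_eq_square)
next
  case False
  with assms have "0 < a" by simp
  have "0 \<le> a * (b * profile w (ln b) x - a * profile w (ln a) x)"
    using profile_increment[OF \<open>0 < a\<close> \<open>a \<le> b\<close>, of x] assms by (intro mult_nonneg_nonneg) auto
  moreover have "(b - a) * (b * 5) \<le> (b - a) * (b * profile w (ln b) x)"
    using assms profile_bounds(1)[of "ln b" x] by (intro mult_left_mono) auto
  ultimately show ?thesis by (simp add: growth_def power2_eq_square algebra_simps)
qed

lemma growth_mono: "0 \<le> a \<Longrightarrow> a \<le> b \<Longrightarrow> growth w a x \<le> growth w b x"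
  using growth_increment[of a b x] mult_nonneg_nonneg[of "5 * b" "b - a"] by linarith

lemma growth_strict_mono: "0 \<le> a \<Longrightarrow> a < b \<Longrightarrow> growth w a x < growth w b x"
  using growth_increment[of a b x] mult_pos_pos[of "5 * b" "b - a"] by linarith

text \<open>The extra term \<open>5 a b\<close> pays for the area in the group law and for moving the base point.\<close>
lemma growth_superadditive:
  assumes "0 \<le> a" "0 \<le> b"
  shows "growth w a x + growth w b x + 5 * a * b \<le> growth w (a + b) x"
proof (cases "a = 0 \<or> b = 0")
  case True
  then show ?thesis by auto
next
  case False
  with assms have ab: "0 < a" "0 < b" by auto
  define m where "m c = c * profile w (ln c) x" for c
  \<comment> \<open>\<open>growth\<close> at \<open>a + b\<close> splits as
    \<open>a * m (a + b) + b * m (a + b)\<close>; each summand gains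
    \<open>5 / 2 * a * b\<close>.\<close>
  have "a * (m a + 5 / 2 * b) + b * (m b + 5 / 2 * a) \<le> a * m (a + b) + b * m (a + b)"
    using ab profile_increment[of a "a + b" x] profile_increment[of b "a + b" x]
    by (intro add_mono mult_left_mono) (auto simp: m_def)
  also have "\<dots> = growth w (a + b) x"
    by (simp add: growth_def m_def power2_eq_square algebra_simps)
  finally show ?thesis
    by (simp add: growth_def m_def power2_eq_square algebra_simps)
qed

text \<open>On the period containing \<open>ln a\<close> the wave has frequency
  \<open>f \<le> exp (2 * pi) / a\<close>, which turns \<open>a\<^sup>2\<close> into
  \<open>a\<close>; the 2 bounds \<open>1 - cos (ln a)\<close>.\<close>

lemma growth_lipschitz:
  assumes "0 \<le> a"
  shows "\<bar>growth w a x - growth w a y\<bar> \<le> 2 * exp (2 * pi) * a * \<bar>x - y\<bar>"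
proof (cases "a = 0")
  case False
  with assms have "0 < a" by simp
  define k :: real where "k = of_int \<lfloor>ln a / (2 * pi)\<rfloor>"
  define f where "f = exp (- 2 * pi * k)"
  have "ln a / (2 * pi) < k + 1" unfolding k_def by linarith
  then have "ln a - 2 * pi * k \<le> 2 * pi" by (simp add: field_simps)
  then have "exp (ln a - 2 * pi * k) \<le> exp (2 * pi)" by simp
  then have e: "a * f \<le> exp (2 * pi)"
    using \<open>0 < a\<close> by (simp add: f_def exp_diff exp_minus divide_inverse)
  have "\<bar>growth w a x - growth w a y\<bar> = a\<^sup>2 * (\<bar>1 - cos (ln a)\<bar> * \<bar>w (x * f) - w (y * f)\<bar>)"
    by (simp add: growth_def profile_def f_def k_def abs_mult flip: right_diff_distrib)
  also have "\<dots> \<le> a\<^sup>2 * (2 * \<bar>x * f - y * f\<bar>)"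
    using cos_ge_minus_one[of "ln a"] cos_le_one[of "ln a"]
    by (intro mult_left_mono mult_mono wave_lipschitz) auto
  also have "\<bar>x * f - y * f\<bar> = f * \<bar>x - y\<bar>"
    by (simp add: f_def abs_mult flip: left_diff_distrib)
  also have "a\<^sup>2 * (2 * (f * \<bar>x - y\<bar>)) = (a * f) * (2 * a * \<bar>x - y\<bar>)"
    by (simp add: power2_eq_square)
  also have "\<dots> \<le> exp (2 * pi) * (2 * a * \<bar>x - y\<bar>)"
    using e assms by (intro mult_right_mono) auto
  finally show ?thesis by (simp add: mult_ac)
qed simp

lemma continuous_on_growth: "continuous_on {0<..} (\<lambda>a. growth w a x)"
proof -
  have "(5 / 2)-lipschitz_on UNIV (\<lambda>s. profile w s x)"
    using profile_lipschitz_abs by (intro lipschitz_onI) (auto simp: dist_real_def)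
  then have "continuous_on UNIV (\<lambda>s. profile w s x)" by (rule lipschitz_on_continuous_on)
  then have "continuous_on {0<..} (\<lambda>a. profile w (ln a) x)"
    by (rule continuous_on_compose2) (auto intro!: continuous_intros)
  then show ?thesis unfolding growth_def by (intro continuous_intros)
qed

section \<open>The inverse function \<open>vertical\<close>\<close>

lemma ex1_growth:
  assumes "0 \<le> u"
  shows "\<exists>!a. 0 \<le> a \<and> growth w a x = u"
proof (rule ex_ex1I)
  show "\<exists>a. 0 \<le> a \<and> growth w a x = u"
  proof (cases "u = 0")
    case False
    with assms have "0 < u" by simp
    have "growth w (sqrt (u / 11)) x \<le> u" "u \<le> growth w (sqrt (u / 5)) x"
      using growth_bounds(2)[of "sqrt (u / 11)" x] growth_bounds(1)[of "sqrt (u / 5)" x] \<open>0 < u\<close>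
      by auto
    moreover have "sqrt (u / 11) \<le> sqrt (u / 5)" using \<open>0 < u\<close> by (simp add: divide_simps)
    moreover have "continuous_on {sqrt (u / 11)..sqrt (u / 5)} (\<lambda>a. growth w a x)"
      using \<open>0 < u\<close> by (intro continuous_on_subset[OF continuous_on_growth]) (auto intro: less_le_trans[rotated])
    ultimately obtain a where "sqrt (u / 11) \<le> a" "growth w a x = u"
      using IVT'[of "\<lambda>a. growth w a x" "sqrt (u / 11)" u "sqrt (u / 5)"] by blast
    moreover have "0 \<le> sqrt (u / 11)" using assms by simp
    ultimately have "0 \<le> a" by linarith
    then show ?thesis using \<open>growth w a x = u\<close> by blast
  qed auto
  show "a = b" if "0 \<le> a \<and> growth w a x = u" "0 \<le> b \<and> growth w b x = u" for a b
    using growth_strict_mono[of a b x] growth_strict_mono[of b a x] that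
    by (cases a b rule: linorder_cases) auto
qed

lemma vertical_inverse:
  assumes "0 \<le> u"
  shows "0 \<le> vertical w u x" "growth w (vertical w u x) x = u"
  using theI'[OF ex1_growth[OF assms, of x]] unfolding vertical_def by auto

lemma vertical_le_iff:
  assumes "0 \<le> u" "0 \<le> a"
  shows "vertical w u x \<le> a \<longleftrightarrow> u \<le> growth w a x"
  using vertical_inverse[OF assms(1), of x] growth_mono[of "vertical w u x" a x]
    growth_strict_mono[of a "vertical w u x" x] assms(2) by (cases "vertical w u x \<le> a") auto

lemma vertical_bounds:
  assumes "0 \<le> u"
  shows "vertical w u x \<le> sqrt u" "sqrt u \<le> 4 * vertical w u x"
proof -
  let ?a = "vertical w u x"
  have a: "0 \<le> ?a" "growth w ?a x = u" using vertical_inverse[OF assms] by auto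
  have "?a\<^sup>2 \<le> u" using growth_bounds(1)[of ?a x] a(2) zero_le_power2[of ?a] by linarith
  then show "?a \<le> sqrt u" by (rule real_le_rsqrt)
  \<comment> \<open>Uses \<open>11 \<le> 16 = 4\<^sup>2\<close>.\<close>
  have "u \<le> (4 * ?a)\<^sup>2"
    unfolding power_mult_distrib
    using order_trans[OF growth_bounds(2)[of ?a x], of "16 * ?a\<^sup>2"] a(2) by simp
  then show "sqrt u \<le> 4 * ?a" using a by (intro real_le_lsqrt) (auto simp: assms)
qed

section \<open>Metric axioms and comparison with \<open>d_cc\<close>\<close>

lemma wave_dist_le_iff:
  assumes "0 \<le> a"
  shows "wave_dist w p q \<le> a \<longleftrightarrow> (2 * exp (2 * pi) + 1) * hgap p q \<le> a
    \<and> \<bar>vgap p q\<bar> \<le> growth w a (fst p + fst q)"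
  using vertical_le_iff[OF abs_ge_zero assms] by (simp add: wave_dist_def)

lemma wave_dist_nonneg: "0 \<le> wave_dist w p q"
  using vertical_inverse(1)[OF abs_ge_zero] by (simp add: wave_dist_def le_max_iff_disj)

text \<open>By \<open>wave_dist_le_iff\<close> only \<open>growth\<close> at \<open>a + b\<close>
  has to be bounded below, not its inverse. The errors are \<open>a * b / 2\<close> from the group
  law and \<open>a * b\<close> from each of two base-point changes, within the gain
  \<open>5 * a * b\<close> of superadditivity.\<close>

lemma wave_dist_triangle: "wave_dist w p r \<le> wave_dist w p q + wave_dist w q r"
proof -
  define a b where "a = wave_dist w p q" and "b = wave_dist w q r"
  have ab: "0 \<le> a" "0 \<le> b" by (simp_all add: a_def b_def wave_dist_nonneg)
  define C where "C = 2 * exp (2 * pi)"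
  have C: "0 < C" by (simp add: C_def)
  let ?m = "hgap p q" and ?n = "hgap q r" and ?x = "fst p + fst r"
  have pq: "(C + 1) * ?m \<le> a" "\<bar>vgap p q\<bar> \<le> growth w a (fst p + fst q)"
    and qr: "(C + 1) * ?n \<le> b" "\<bar>vgap q r\<bar> \<le> growth w b (fst q + fst r)"
    using wave_dist_le_iff[OF ab(1), of p q] wave_dist_le_iff[OF ab(2), of q r]
    by (simp_all add: a_def b_def C_def)
  have h0: "0 \<le> ?m" "0 \<le> ?n" by (simp_all add: hgap_def)
  have m: "?m \<le> a" "C * ?m \<le> a" and n: "?n \<le> b" "C * ?n \<le> b"
    using pq(1) qr(1) h0 C mult_nonneg_nonneg[of C ?m] mult_nonneg_nonneg[of C ?n]
    unfolding distrib_right by linarith+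
  \<comment> \<open>The symplectic form of the two horizontal displacements; half of it is the
    defect of additivity of \<open>vgap\<close>.\<close>
  define \<omega> where "\<omega> = (fst q - fst p) * (fst (snd r) - fst (snd q))
      - (fst (snd q) - fst (snd p)) * (fst r - fst q)"
  have v: "vgap p r = vgap p q + vgap q r + \<omega> / 2"
    unfolding vgap_def \<omega>_def by (simp add: field_simps)
  have "\<bar>\<omega>\<bar> \<le> \<bar>fst q - fst p\<bar> * \<bar>fst (snd r) - fst (snd q)\<bar>
      + \<bar>fst (snd q) - fst (snd p)\<bar> * \<bar>fst r - fst q\<bar>"
    unfolding \<omega>_def abs_mult[symmetric] by (rule abs_triangle_ineq4)
  also have "\<dots> \<le> ?m * ?n"
    by (simp add: hgap_def algebra_simps)
  also have "\<dots> \<le> a * b" using m n h0 ab by (intro mult_mono) auto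
  finally have \<omega>: "\<bar>\<omega>\<bar> \<le> a * b" .
  \<comment> \<open>Replacing \<open>fst p + fst q\<close> by \<open>fst p + fst r\<close> moves the
    base point by at most \<open>hgap q r\<close>, and \<open>C * hgap q r \<le> b\<close>.\<close>
  have "growth w a (fst p + fst q) \<le> growth w a ?x + C * a * \<bar>(fst p + fst q) - ?x\<bar>"
    using growth_lipschitz[OF ab(1), of "fst p + fst q" ?x] unfolding C_def abs_le_iff by linarith
  also have "C * a * \<bar>(fst p + fst q) - ?x\<bar> \<le> C * a * ?n"
    using C ab by (intro mult_left_mono) (auto simp: hgap_def)
  also have "\<dots> \<le> a * b"
    using mult_left_mono[OF n(2) ab(1)] by (simp add: mult_ac)
  finally have 1: "growth w a (fst p + fst q) \<le> growth w a ?x + a * b" by simp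
  have "growth w b (fst q + fst r) \<le> growth w b ?x + C * b * \<bar>(fst q + fst r) - ?x\<bar>"
    using growth_lipschitz[OF ab(2), of "fst q + fst r" ?x] unfolding C_def abs_le_iff by linarith
  also have "C * b * \<bar>(fst q + fst r) - ?x\<bar> \<le> C * b * ?m"
    using C ab by (intro mult_left_mono) (auto simp: hgap_def)
  also have "\<dots> \<le> a * b"
    using mult_left_mono[OF m(2) ab(2)] by (simp add: mult_ac)
  finally have 2: "growth w b (fst q + fst r) \<le> growth w b ?x + a * b" by simp
  have "\<bar>vgap p r\<bar> \<le> \<bar>vgap p q\<bar> + \<bar>vgap q r\<bar> + \<bar>\<omega>\<bar> / 2"
    unfolding v by linarith
  also have "\<dots> \<le> growth w (a + b) ?x"
    using pq(2) qr(2) \<omega> 1 2 growth_superadditive[OF ab, of ?x] mult_nonneg_nonneg[OF ab]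
    by linarith
  finally have "\<bar>vgap p r\<bar> \<le> growth w (a + b) ?x" .
  moreover have "(C + 1) * hgap p r \<le> (C + 1) * (?m + ?n)"
    using C by (intro mult_left_mono) (auto simp: hgap_def)
  then have "(C + 1) * hgap p r \<le> a + b"
    using pq(1) qr(1) unfolding distrib_left by linarith
  ultimately show ?thesis
    using wave_dist_le_iff[of "a + b" p r] ab by (simp add: C_def flip: a_def b_def)
qed

lemma Metric_space_wave_dist: "Metric_space UNIV (wave_dist w)"
proof
  fix p q r :: heis
  show "0 \<le> wave_dist w p q" by (rule wave_dist_nonneg)
  have "hgap p q = hgap q p" by (simp add: hgap_def abs_minus_commute)
  moreover have "vgap q p = - vgap p q" by (simp add: vgap_def field_simps)
  ultimately show "wave_dist w p q = wave_dist w q p"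
    by (simp add: wave_dist_def add.commute)
  show "wave_dist w p r \<le> wave_dist w p q + wave_dist w q r" by (rule wave_dist_triangle)
  have K: "0 < 2 * exp (2 * pi) + (1::real)" by (simp add: add_pos_pos)
  have "wave_dist w p q = 0 \<longleftrightarrow> hgap p q \<le> 0 \<and> vgap p q = 0"
    using wave_dist_le_iff[of 0 p q] wave_dist_nonneg[of p q] K by (auto simp: mult_le_0_iff)
  also have "hgap p q \<le> 0 \<longleftrightarrow> fst p = fst q \<and> fst (snd p) = fst (snd q)"
    unfolding hgap_def by linarith
  also have "\<dots> \<and> vgap p q = 0 \<longleftrightarrow> p = q"
    by (auto simp: vgap_def prod_eq_iff)
  finally show "wave_dist w p q = 0 \<longleftrightarrow> p = q" .
qed

lemma bilipschitz_equiv_wave_dist: "bilipschitz_equiv (wave_dist w) d_cc"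
proof -
  define K where "K = 2 * exp (2 * pi) + (1::real)"
  have K: "1 \<le> K" by (simp add: K_def)
  \<comment> \<open>\<open>22500 = 4500 * 5\<close>, where \<open>5 = 1 + 4\<close> comes from
    \<open>hgap\<close> and from \<open>sqrt u \<le> 4 * vertical w u x\<close>. The summand
    \<open>3 * K\<close> serves the other inequality.\<close>
  have "d_cc p q / (22500 + 3 * K) \<le> wave_dist w p q
      \<and> wave_dist w p q \<le> (22500 + 3 * K) * d_cc p q" for p q
  proof -
    let ?h = "hgap p q" and ?s = "sqrt \<bar>vgap p q\<bar>"
    let ?v = "vertical w \<bar>vgap p q\<bar> (fst p + fst q)"
    have d: "wave_dist w p q = max (K * ?h) ?v" by (simp add: wave_dist_def K_def)
    have h: "0 \<le> ?h" by (simp add: hgap_def)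
    have s: "0 \<le> ?s" by simp
    have v: "?v \<le> ?s" "?s \<le> 4 * ?v" by (rule vertical_bounds; simp)+
    have Kh: "?h \<le> K * ?h" "?s \<le> K * ?s" using mult_right_mono[OF K h] mult_right_mono[OF K s] by simp_all
    have dc: "?h + ?s \<le> 3 * d_cc p q" "d_cc p q \<le> 4500 * (?h + ?s)" by (rule d_cc_bounds)+
    then have dc0: "0 \<le> d_cc p q" using h s by linarith
    have "?h + ?s \<le> 5 * wave_dist w p q" using v Kh by (simp add: d)
    then have "4500 * (?h + ?s) \<le> 4500 * (5 * wave_dist w p q)" by (rule mult_left_mono) simp
    with dc(2) have "d_cc p q \<le> 22500 * wave_dist w p q" by simp
    also have "\<dots> \<le> (22500 + 3 * K) * wave_dist w p q"
      using K wave_dist_nonneg by (intro mult_right_mono) auto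
    finally have 1: "d_cc p q / (22500 + 3 * K) \<le> wave_dist w p q"
      using K by (simp add: pos_divide_le_eq mult.commute)
    have "wave_dist w p q \<le> K * (?h + ?s)" using v Kh h s K by (simp add: d distrib_left)
    also have "\<dots> \<le> K * (3 * d_cc p q)" using K dc by (intro mult_left_mono) auto
    also have "\<dots> \<le> (22500 + 3 * K) * d_cc p q" using dc0 by (simp add: algebra_simps)
    finally show ?thesis using 1 by blast
  qed
  then show ?thesis
    unfolding bilipschitz_equiv_def using K by (intro exI[of _ "22500 + 3 * K"]) auto
qed

end

section \<open>Blow-ups\<close>

lemma sqrt_2_irrational:
  fixes m n :: int
  assumes "of_int m = sqrt 2 * of_int n"
  shows "n = 0"
proof (rule ccontr)
  assume "n \<noteq> 0"
  then have "sqrt 2 = of_int m / of_int n" using assms by simp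
  then have "sqrt 2 \<in> \<rat>" by simp
  then obtain p q :: nat where "q \<noteq> 0" and pq: "\<bar>sqrt 2\<bar> = real p / real q" and cop: "coprime p q"
    by (rule Rats_abs_nat_div_natE)
  then have "real p = sqrt 2 * real q" by simp
  then have "(real p)\<^sup>2 = 2 * (real q)\<^sup>2" by (simp add: power_mult_distrib)
  then have eq: "p\<^sup>2 = 2 * q\<^sup>2"
    by (metis of_nat_eq_iff of_nat_mult of_nat_numeral of_nat_power)
  then have "even p" by (metis dvd_triv_left even_power pos2)
  then obtain k where "p = 2 * k" by (elim dvdE)
  with eq have "q\<^sup>2 = 2 * k\<^sup>2" by (simp add: power_mult_distrib)
  then have "even q" by (metis dvd_triv_left even_power pos2)
  with \<open>even p\<close> cop show False by (metis coprime_common_divisor odd_one)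
qed

text \<open>Sum-to-product formulas turn the period into an identity between waves of frequencies
  \<open>sqrt 2\<close> and 1. Both amplitudes must vanish, so \<open>T / 2\<close> and
  \<open>sqrt 2 * T / 2\<close> are both integer multiples of \<open>pi\<close>.\<close>

lemma quasiperiodic_not_periodic:
  assumes per: "\<And>s. sin (sqrt 2 * (s + T) + v) - cos (s + T + u) = sin (sqrt 2 * s + v) - cos (s + u)"
    and "T > 0"
  shows False
proof -
  define a where "a = sin (sqrt 2 * T / 2)"
  have eq: "a * cos (sqrt 2 * s + sqrt 2 * T / 2 + v) = - sin (s + T / 2 + u) * sin (T / 2)" for s
  proof -
    have halves: "(sqrt 2 * (s + T) + v - (sqrt 2 * s + v)) / 2 = sqrt 2 * T / 2"
      "(sqrt 2 * (s + T) + v + (sqrt 2 * s + v)) / 2 = sqrt 2 * s + sqrt 2 * T / 2 + v"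
      "(s + T + u + (s + u)) / 2 = s + T / 2 + u" "(s + u - (s + T + u)) / 2 = - (T / 2)"
      by (simp_all add: field_simps)
    have "sin (sqrt 2 * (s + T) + v) - sin (sqrt 2 * s + v) = cos (s + T + u) - cos (s + u)"
      using per[of s] by linarith
    then have "2 * (a * cos (sqrt 2 * s + sqrt 2 * T / 2 + v)) = 2 * (sin (s + T / 2 + u) * sin (- (T / 2)))"
      unfolding sin_diff_sin cos_diff_cos halves a_def by simp
    then show ?thesis by simp
  qed
  have "a = 0"
  proof (rule ccontr)
    assume "a \<noteq> 0"
    \<comment> \<open>This \<open>s\<close> puts the cosine at its maximum. A shift by
      \<open>2 * pi\<close> leaves the right-hand side of \<open>eq\<close> unchanged, so the cosine
      would be maximal again, making \<open>sqrt 2\<close> an integer.\<close>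
    define s where "s = - (sqrt 2 * T / 2 + v) / sqrt 2"
    have s: "sqrt 2 * s + sqrt 2 * T / 2 + v = 0" by (simp add: s_def)
    have "sin (s + 2 * pi + T / 2 + u) = sin (s + T / 2 + u)"
      using sin_periodic[of "s + T / 2 + u"] by (simp add: add_ac)
    then have "a * cos (sqrt 2 * (s + 2 * pi) + sqrt 2 * T / 2 + v) = a * cos 0"
      using eq[of "s + 2 * pi"] eq[of s] unfolding s by simp
    moreover have "sqrt 2 * (s + 2 * pi) + sqrt 2 * T / 2 + v = sqrt 2 * (2 * pi)"
      using s by (simp add: distrib_left)
    ultimately have "cos (sqrt 2 * (2 * pi)) = 1" using \<open>a \<noteq> 0\<close> by simp
    then obtain n :: int where "sqrt 2 * (2 * pi) = of_int n * 2 * pi"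
      unfolding cos_one_2pi_int by blast
    then have "of_int n = sqrt 2 * of_int 1" by simp
    then show False using sqrt_2_irrational by fastforce
  qed
  then obtain m :: int where m: "sqrt 2 * T / 2 = of_int m * pi"
    unfolding a_def sin_zero_iff_int2 by blast
  have "sin (T / 2) = 0"
    using eq[of "pi / 2 - T / 2 - u"] \<open>a = 0\<close> by simp
  then obtain n :: int where n: "T / 2 = of_int n * pi"
    unfolding sin_zero_iff_int2 by blast
  have "sqrt 2 * (T / 2) = of_int m * pi" using m by simp
  then have "of_int m = sqrt 2 * of_int n" unfolding n by simp
  then have "n = 0" by (rule sqrt_2_irrational)
  then show False using n \<open>T > 0\<close> by simp
qed

section \<open>Limit phases, limit laws and self-similarity\<close>

definition mod_2pi :: "real \<Rightarrow> real" where
  "mod_2pi t = t - 2 * pi * of_int \<lfloor>t / (2 * pi)\<rfloor>"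

lemma mod_2pi_range: "mod_2pi t \<in> {0..2 * pi}"
proof -
  define k :: real where "k = of_int \<lfloor>t / (2 * pi)\<rfloor>"
  have "k \<le> t / (2 * pi)" "t / (2 * pi) < k + 1" unfolding k_def by linarith+
  then have "2 * pi * k \<le> t" "t \<le> 2 * pi * (k + 1)"
    by (simp_all add: pos_le_divide_eq pos_divide_less_eq mult_ac)
  then show ?thesis
    by (simp add: mod_2pi_def k_def[symmetric] distrib_left)
qed

lemma sin_add_mod_2pi: "sin (s + mod_2pi t) = sin (s + t)"
  and cos_add_mod_2pi: "cos (s + mod_2pi t) = cos (s + t)"
proof -
  have *: "s + mod_2pi t = (s + t) - 2 * pi * of_int \<lfloor>t / (2 * pi)\<rfloor>" by (simp add: mod_2pi_def)
  show "sin (s + mod_2pi t) = sin (s + t)" "cos (s + mod_2pi t) = cos (s + t)"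
    unfolding * sin_diff cos_diff sin_int_2pin cos_int_2pin by simp_all
qed

text \<open>Logarithms of scales diverge, but the oscillations see them only modulo
  \<open>2 * pi\<close>, so compactness of a square yields simultaneous limits.\<close>

lemma convergent_mod_2pi_subsequence:
  obtains \<sigma> :: "nat \<Rightarrow> nat" and l m where "strict_mono \<sigma>"
    "(\<lambda>j. mod_2pi (f (\<sigma> j))) \<longlonglongrightarrow> l" "(\<lambda>j. mod_2pi (g (\<sigma> j))) \<longlonglongrightarrow> m"
proof -
  have "compact ({0..2 * pi} \<times> {0..2 * pi})" by (intro compact_Times compact_Icc)
  moreover have "\<forall>j. (mod_2pi (f j), mod_2pi (g j)) \<in> {0..2 * pi} \<times> {0..2 * pi}"
    using mod_2pi_range by blast
  ultimately obtain l \<sigma> where \<sigma>: "strict_mono \<sigma>"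
    and lim: "((\<lambda>j. (mod_2pi (f j), mod_2pi (g j))) \<circ> \<sigma>) \<longlonglongrightarrow> l"
    unfolding compact_eq_seq_compact_metric by (elim seq_compactE) auto
  show thesis
    using that[OF \<sigma>] tendsto_fst[OF lim] tendsto_snd[OF lim] by (simp add: o_def)
qed

text \<open>The law replacing \<open>growth\<close> in a blow-up: \<open>u\<close> and
  \<open>v\<close> are limit phases of the two oscillations, \<open>c\<close> a limit value of the
  wave.\<close>

definition limit_growth :: "real \<Rightarrow> real \<Rightarrow> real \<Rightarrow> real \<Rightarrow> real" where
  "limit_growth u v c a = a\<^sup>2 * (8 + sin (sqrt 2 * ln a + v) + (1 - cos (ln a + u)) * c)"

text \<open>On these vertical segments the horizontal term of \<open>wave_dist\<close>
  vanishes.\<close>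

definition vdist :: "(heis \<Rightarrow> heis \<Rightarrow> real) \<Rightarrow> real \<Rightarrow> real \<Rightarrow> real" where
  "vdist D x z = D (x, 0, 0) (x, 0, z)"

text \<open>The hypotheses make \<open>limit_growth u v 1 a\<close> the largest height at distance
  \<open>a\<close> over all base points. A dilation preserving \<open>D\<close> up to its factor
  must rescale this envelope by \<open>r\<^sup>2\<close>, so the oscillating factor has period
  \<open>ln r\<close> in \<open>ln a\<close>.\<close>

lemma not_self_similar:
  assumes le: "\<And>x z. 0 < z \<Longrightarrow> 0 < vdist D x z \<and> z \<le> limit_growth u v 1 (vdist D x z)"
    and ex: "\<And>a. 0 < a \<Longrightarrow> 0 < limit_growth u v 1 a \<and> (\<exists>x. vdist D x (limit_growth u v 1 a) = a)"
  shows "\<not> self_similar D"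
proof
  assume "self_similar D"
  then obtain r where "r > 1" and r: "\<And>p q. D (hdil r p) (hdil r q) = r * D p q"
    unfolding self_similar_def by blast
  have scale: "vdist D (r * x) (r\<^sup>2 * z) = r * vdist D x z" for x z
    using r[of "(x, 0, 0)" "(x, 0, z)"] by (simp add: vdist_def)
  have "limit_growth u v 1 (r * a) = r\<^sup>2 * limit_growth u v 1 a" if a: "0 < a" for a
  proof (rule antisym)
    obtain x where x: "vdist D x (limit_growth u v 1 a) = a" using ex[OF a] by blast
    show "r\<^sup>2 * limit_growth u v 1 a \<le> limit_growth u v 1 (r * a)"
      using le[of "r\<^sup>2 * limit_growth u v 1 a" "r * x"] ex[OF a] \<open>r > 1\<close>
      by (simp add: scale x)
    have ra: "0 < r * a" using a \<open>r > 1\<close> by simp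
    obtain x where x: "vdist D x (limit_growth u v 1 (r * a)) = r * a" using ex ra by blast
    have "r * vdist D (x / r) (limit_growth u v 1 (r * a) / r\<^sup>2) = r * a"
      using scale[of "x / r" "limit_growth u v 1 (r * a) / r\<^sup>2"] x \<open>r > 1\<close> by simp
    then have "vdist D (x / r) (limit_growth u v 1 (r * a) / r\<^sup>2) = a" using \<open>r > 1\<close> by simp
    then have "limit_growth u v 1 (r * a) / r\<^sup>2 \<le> limit_growth u v 1 a"
      using le[of "limit_growth u v 1 (r * a) / r\<^sup>2" "x / r"] ex[OF ra] \<open>r > 1\<close> by simp
    then show "limit_growth u v 1 (r * a) \<le> r\<^sup>2 * limit_growth u v 1 a"
      using \<open>r > 1\<close> by (simp add: pos_divide_le_eq mult.commute)
  qed
  then have *: "limit_growth u v 1 (r * exp s) = r\<^sup>2 * limit_growth u v 1 (exp s)" for s by simp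
  have "sin (sqrt 2 * (s + ln r) + v) - cos (s + ln r + u) = sin (sqrt 2 * s + v) - cos (s + u)" for s
  proof -
    have "ln (r * exp s) = s + ln r" using \<open>r > 1\<close> by (simp add: ln_mult)
    then show ?thesis
      using *[of s] \<open>r > 1\<close> by (simp add: limit_growth_def power_mult_distrib)
  qed
  then show False using quasiperiodic_not_periodic \<open>r > 1\<close> ln_gt_zero by blast
qed

section \<open>Passing to the limit in the vertical distances\<close>

context wave
begin

text \<open>Dividing the defining equation of \<open>vertical\<close> by \<open>r\<^sup>2\<close>
  shows that rescaling only adds \<open>ln r\<close> to the phase.\<close>

lemma wave_dist_vertical:
  fixes r x z :: real and g :: heis
  assumes "0 < r" "0 < z"
  defines "E \<equiv> (1 / r) * wave_dist w (hmul g (hdil r (x, 0, 0))) (hmul g (hdil r (x, 0, z)))"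
  shows "sqrt (z / 11) \<le> E" "E\<^sup>2 * profile w (ln E + ln r) (2 * fst g + 2 * r * x) = z"
proof -
  obtain \<alpha> \<beta> \<gamma> where g: "g = (\<alpha>, \<beta>, \<gamma>)" by (metis surj_pair)
  let ?X = "2 * fst g + 2 * r * x"
  have "wave_dist w (hmul g (hdil r (x, 0, 0))) (hmul g (hdil r (x, 0, z)))
      = max 0 (vertical w (r\<^sup>2 * z) ?X)"
    using assms by (simp add: wave_dist_def hgap_def vgap_def g field_simps)
  then have "r * E = vertical w (r\<^sup>2 * z) ?X"
    using assms vertical_inverse(1)[of "r\<^sup>2 * z" ?X] by (simp add: E_def)
  then have E0: "0 \<le> r * E" and eq: "growth w (r * E) ?X = r\<^sup>2 * z"
    using vertical_inverse[of "r\<^sup>2 * z" ?X] assms by auto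
  then have "0 \<le> E" using assms by (simp add: zero_le_mult_iff)
  moreover have "E \<noteq> 0" using eq assms by auto
  ultimately have "0 < E" by simp
  then have "r\<^sup>2 * (E\<^sup>2 * profile w (ln E + ln r) ?X) = r\<^sup>2 * z"
    using eq assms(1,2) by (simp add: growth_def power_mult_distrib ln_mult add.commute)
  then show z: "E\<^sup>2 * profile w (ln E + ln r) ?X = z" using assms by simp
  have "z \<le> E\<^sup>2 * 11"
    unfolding z[symmetric] by (intro mult_left_mono profile_bounds) auto
  then show "sqrt (z / 11) \<le> E" using \<open>0 < E\<close> by (intro real_le_lsqrt) auto
qed

text \<open>After passing to a subsequence with convergent phases, the rescaled distances solve
  exact equations. Their limit solves them up to an error tending to 0, the profile being bounded
  and Lipschitz in the logarithm of the distance.\<close>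

lemma blow_up_profile:
  assumes "is_blow_up (wave_dist w) D"
  shows "\<exists>r u v \<alpha>. (\<forall>j::nat. 0 < r j)
    \<and> (\<forall>s. (\<lambda>j. cos (s + ln (r j))) \<longlonglongrightarrow> cos (s + u))
    \<and> (\<forall>s. (\<lambda>j. sin (sqrt 2 * (s + ln (r j)))) \<longlonglongrightarrow> sin (sqrt 2 * s + v))
    \<and> (\<forall>x z. 0 < z \<longrightarrow> 0 < vdist D x z)
    \<and> (\<forall>x z. 0 < z \<longrightarrow> (\<lambda>j. (vdist D x z)\<^sup>2 *
        profile w (ln (vdist D x z) + ln (r j)) (2 * \<alpha> j + 2 * r j * x)) \<longlonglongrightarrow> z)"
proof -
  obtain r0 :: "nat \<Rightarrow> real" and g0 :: "nat \<Rightarrow> heis" where r0: "\<And>j. 0 < r0 j"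
    and lim0: "\<And>p1 p2. (\<lambda>j. (1 / r0 j) * wave_dist w (hmul (g0 j) (hdil (r0 j) p1)) (hmul (g0 j) (hdil (r0 j) p2)))
          \<longlonglongrightarrow> D p1 p2"
    using assms unfolding is_blow_up_def by blast
  obtain \<sigma> u v where \<sigma>: "strict_mono \<sigma>"
    and uv: "(\<lambda>j. mod_2pi (ln (r0 (\<sigma> j)))) \<longlonglongrightarrow> u" "(\<lambda>j. mod_2pi (sqrt 2 * ln (r0 (\<sigma> j)))) \<longlonglongrightarrow> v"
    by (rule convergent_mod_2pi_subsequence[of "\<lambda>j. ln (r0 j)" "\<lambda>j. sqrt 2 * ln (r0 j)"])
  define r g where "r = r0 \<circ> \<sigma>" and "g = g0 \<circ> \<sigma>"
  have r: "0 < r j" for j by (simp add: r_def r0)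
  have lim: "(\<lambda>j. (1 / r j) * wave_dist w (hmul (g j) (hdil (r j) p1)) (hmul (g j) (hdil (r j) p2)))
      \<longlonglongrightarrow> D p1 p2" for p1 p2
    using LIMSEQ_subseq_LIMSEQ[OF lim0 \<sigma>] by (simp add: r_def g_def o_def)
  show ?thesis
  proof (rule exI[of _ r], rule exI[of _ u], rule exI[of _ v], rule exI[of _ "\<lambda>j. fst (g j)"],
      intro conjI allI impI)
    show "0 < r j" for j by (rule r)
    show "(\<lambda>j. cos (s + ln (r j))) \<longlonglongrightarrow> cos (s + u)" for s
      using tendsto_cos[OF tendsto_add[OF tendsto_const uv(1)], of s]
      by (simp add: cos_add_mod_2pi r_def)
    show "(\<lambda>j. sin (sqrt 2 * (s + ln (r j)))) \<longlonglongrightarrow> sin (sqrt 2 * s + v)" for s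
      using tendsto_sin[OF tendsto_add[OF tendsto_const uv(2)], of "sqrt 2 * s"]
      by (simp add: sin_add_mod_2pi r_def distrib_left)
  next
    fix x z :: real assume "0 < z"
    define E where "E j = (1 / r j) * wave_dist w (hmul (g j) (hdil (r j) (x, 0, 0))) (hmul (g j) (hdil (r j) (x, 0, z)))" for j
    let ?d = "vdist D x z"
    define X where "X j = 2 * fst (g j) + 2 * r j * x" for j
    have E: "E \<longlonglongrightarrow> ?d" unfolding E_def vdist_def by (rule lim)
    have low: "sqrt (z / 11) \<le> E j" and eq: "(E j)\<^sup>2 * profile w (ln (E j) + ln (r j)) (X j) = z" for j
      using wave_dist_vertical[OF r \<open>0 < z\<close>] by (simp_all add: E_def X_def)
    \<comment> \<open>The uniform lower bound keeps the limit positive, so \<open>ln\<close> is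
      continuous there.\<close>
    have "sqrt (z / 11) \<le> ?d" by (rule LIMSEQ_le_const[OF E]) (use low in auto)
    moreover have "0 < sqrt (z / 11)" using \<open>0 < z\<close> by simp
    ultimately show d: "0 < ?d" by linarith
    show "(\<lambda>j. ?d\<^sup>2 * profile w (ln ?d + ln (r j)) (X j)) \<longlonglongrightarrow> z"
    proof (rule LIM_zero_cancel, rule Lim_null_comparison)
      have "\<bar>?d\<^sup>2 * P - z\<bar> \<le> \<bar>?d\<^sup>2 - (E j)\<^sup>2\<bar> * 11 + (E j)\<^sup>2 * (5 / 2 * \<bar>ln ?d - ln (E j)\<bar>)"
        if P: "P = profile w (ln ?d + ln (r j)) (X j)" for P j
      proof -
        define Q where "Q = profile w (ln (E j) + ln (r j)) (X j)"
        \<comment> \<open>The first term is controlled by the bound 11 of the profile, the second by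
          its Lipschitz constant.\<close>
        have "?d\<^sup>2 * P - z = (?d\<^sup>2 - (E j)\<^sup>2) * P + (E j)\<^sup>2 * (P - Q)"
          using eq[of j] by (simp add: Q_def algebra_simps)
        then have "\<bar>?d\<^sup>2 * P - z\<bar> \<le> \<bar>?d\<^sup>2 - (E j)\<^sup>2\<bar> * \<bar>P\<bar> + (E j)\<^sup>2 * \<bar>P - Q\<bar>"
          using abs_triangle_ineq[of "(?d\<^sup>2 - (E j)\<^sup>2) * P" "(E j)\<^sup>2 * (P - Q)"] by (simp add: abs_mult)
        also have "\<dots> \<le> \<bar>?d\<^sup>2 - (E j)\<^sup>2\<bar> * 11 + (E j)\<^sup>2 * (5 / 2 * \<bar>ln ?d - ln (E j)\<bar>)"
        proof (intro add_mono mult_left_mono)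
          show "\<bar>P\<bar> \<le> 11" using profile_bounds[of "ln ?d + ln (r j)" "X j"] by (simp add: P)
          show "\<bar>P - Q\<bar> \<le> 5 / 2 * \<bar>ln ?d - ln (E j)\<bar>"
            using profile_lipschitz_abs[of "ln ?d + ln (r j)" "X j" "ln (E j) + ln (r j)"]
            by (simp add: P Q_def)
        qed auto
        finally show ?thesis .
      qed
      then show "\<forall>\<^sub>F j in sequentially. norm (?d\<^sup>2 * profile w (ln ?d + ln (r j)) (X j) - z)
          \<le> \<bar>?d\<^sup>2 - (E j)\<^sup>2\<bar> * 11 + (E j)\<^sup>2 * (5 / 2 * \<bar>ln ?d - ln (E j)\<bar>)"
        by (simp only: real_norm_def) simp
      have "(\<lambda>j. \<bar>?d\<^sup>2 - (E j)\<^sup>2\<bar> * 11 + (E j)\<^sup>2 * (5 / 2 * \<bar>ln ?d - ln (E j)\<bar>))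
          \<longlonglongrightarrow> \<bar>?d\<^sup>2 - ?d\<^sup>2\<bar> * 11 + ?d\<^sup>2 * (5 / 2 * \<bar>ln ?d - ln ?d\<bar>)"
        using d by (intro tendsto_intros E) auto
      then show "(\<lambda>j. \<bar>?d\<^sup>2 - (E j)\<^sup>2\<bar> * 11 + (E j)\<^sup>2 * (5 / 2 * \<bar>ln ?d - ln (E j)\<bar>)) \<longlonglongrightarrow> 0" by simp
    qed
  qed
qed

text \<open>\<open>growth_increment\<close> at scale \<open>r j\<close>, divided by
  \<open>(r j)\<^sup>2\<close>, leaves a gap \<open>5 * b * (b - a)\<close> independent of
  \<open>j\<close>, which survives in the limit.\<close>

lemma scaled_growth_limit_le:
  assumes "0 < a" "0 < b" and r: "\<And>j::nat. 0 < r j"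
    and a: "(\<lambda>j. a\<^sup>2 * profile w (ln a + ln (r j)) (X j)) \<longlonglongrightarrow> z"
    and b: "(\<lambda>j. b\<^sup>2 * profile w (ln b + ln (r j)) (X j)) \<longlonglongrightarrow> z"
  shows "b \<le> a"
proof (rule ccontr)
  assume "\<not> b \<le> a"
  have "5 * b * (b - a) \<le> b\<^sup>2 * profile w (ln b + ln (r j)) (X j) - a\<^sup>2 * profile w (ln a + ln (r j)) (X j)" for j
  proof -
    have "5 * (r j * b) * (r j * b - r j * a) \<le> growth w (r j * b) (X j) - growth w (r j * a) (X j)"
      using assms(1,2) r[of j] \<open>\<not> b \<le> a\<close> by (intro growth_increment) auto
    then have "(r j)\<^sup>2 * (5 * b * (b - a)) \<le> (r j)\<^sup>2 *
        (b\<^sup>2 * profile w (ln b + ln (r j)) (X j) - a\<^sup>2 * profile w (ln a + ln (r j)) (X j))"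
      using assms(1,2) r[of j]
      by (simp add: growth_def ln_mult power_mult_distrib algebra_simps power2_eq_square)
    then show ?thesis using r[of j] by (simp del: right_diff_distrib)
  qed
  then have "5 * b * (b - a) \<le> z - z"
    by (intro LIMSEQ_le_const[OF tendsto_diff[OF b a]]) auto
  moreover have "0 < 5 * b * (b - a)" using assms \<open>\<not> b \<le> a\<close> by simp
  ultimately show False by simp
qed

lemma scaled_growth_limit_inj:
  assumes "0 < a" "0 < b" and "\<And>j::nat. 0 < r j"
    and "(\<lambda>j. a\<^sup>2 * profile w (ln a + ln (r j)) (X j)) \<longlonglongrightarrow> z"
    and "(\<lambda>j. b\<^sup>2 * profile w (ln b + ln (r j)) (X j)) \<longlonglongrightarrow> z"
  shows "a = b"
  using scaled_growth_limit_le[of a b r X z] scaled_growth_limit_le[of b a r X z] assms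
  by (intro antisym) auto

text \<open>As \<open>w \<le> 1\<close> and \<open>1 - cos \<ge> 0\<close>, the wave may be replaced
  by 1 before the limit; the bound thus holds even where the wave does not converge.\<close>

lemma vdist_le_limit_growth:
  assumes cos_lim: "\<And>s. (\<lambda>j. cos (s + ln (r j))) \<longlonglongrightarrow> cos (s + u)"
    and sin_lim: "\<And>s. (\<lambda>j. sin (sqrt 2 * (s + ln (r j)))) \<longlonglongrightarrow> sin (sqrt 2 * s + v)"
    and lim: "(\<lambda>j. d\<^sup>2 * profile w (ln d + ln (r j)) (X j)) \<longlonglongrightarrow> z"
  shows "z \<le> limit_growth u v 1 d"
proof (rule LIMSEQ_le[OF lim])
  show "(\<lambda>j. d\<^sup>2 * (8 + sin (sqrt 2 * (ln d + ln (r j))) + (1 - cos (ln d + ln (r j))) * 1))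
      \<longlonglongrightarrow> limit_growth u v 1 d"
    unfolding limit_growth_def by (intro tendsto_intros cos_lim sin_lim)
  have "w y \<le> 1" for y using wave_bound[of y] by simp
  then show "\<exists>N. \<forall>n\<ge>N. d\<^sup>2 * profile w (ln d + ln (r n)) (X n)
      \<le> d\<^sup>2 * (8 + sin (sqrt 2 * (ln d + ln (r n))) + (1 - cos (ln d + ln (r n))) * 1)"
    unfolding profile_def by (intro exI[of _ 0] allI impI mult_left_mono add_left_mono) auto
qed

text \<open>Along a subsequence on which the wave settles at the value \<open>c\<close>, the limit law is
  the inverse of \<open>limit_growth u v c\<close>.\<close>
lemma vdist_eq_of_wave_limit:
  assumes r: "\<And>j::nat. 0 < r j"
    and cos_lim: "\<And>s. (\<lambda>j. cos (s + ln (r j))) \<longlonglongrightarrow> cos (s + u)"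
    and sin_lim: "\<And>s. (\<lambda>j. sin (sqrt 2 * (s + ln (r j)))) \<longlonglongrightarrow> sin (sqrt 2 * s + v)"
    and pos: "\<And>z. 0 < z \<Longrightarrow> 0 < d z"
    and lim: "\<And>z. 0 < z \<Longrightarrow> (\<lambda>j. (d z)\<^sup>2 * profile w (ln (d z) + ln (r j)) (X j)) \<longlonglongrightarrow> z"
    and "0 < a" and \<tau>: "strict_mono \<tau>"
    and wave_lim: "(\<lambda>j. w (X (\<tau> j) * exp (- 2 * pi * of_int \<lfloor>(ln a + ln (r (\<tau> j))) / (2 * pi)\<rfloor>))) \<longlonglongrightarrow> c"
  shows "0 < limit_growth u v c a" "d (limit_growth u v c a) = a"
proof -
  let ?z = "limit_growth u v c a"
  have a: "(\<lambda>j. a\<^sup>2 * profile w (ln a + ln (r (\<tau> j))) (X (\<tau> j))) \<longlonglongrightarrow> ?z"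
    unfolding limit_growth_def profile_def
    by (intro tendsto_intros wave_lim LIMSEQ_subseq_LIMSEQ[OF cos_lim \<tau>, unfolded o_def]
        LIMSEQ_subseq_LIMSEQ[OF sin_lim \<tau>, unfolded o_def])
  have "a\<^sup>2 * 5 \<le> ?z"
    by (rule LIMSEQ_le_const[OF a]) (auto intro!: mult_left_mono profile_bounds)
  moreover have "0 < a\<^sup>2 * 5" using \<open>0 < a\<close> by simp
  ultimately show z: "0 < ?z" by linarith
  show "d ?z = a"
    using LIMSEQ_subseq_LIMSEQ[OF lim[OF z] \<tau>, unfolded o_def] a pos[OF z] \<open>0 < a\<close> r
    by (intro scaled_growth_limit_inj[of _ _ "\<lambda>j. r (\<tau> j)" "\<lambda>j. X (\<tau> j)"]) auto
qed

end

section \<open>The left-invariant distance and the modulated distance\<close>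

interpretation const: wave "\<lambda>_. 1"
  by unfold_locales auto

interpretation sine: wave sin
  by unfold_locales (auto simp: abs_sin_diff_le abs_sin_le_one)

text \<open>A constant wave forgets the base point, and \<open>hgap\<close> and \<open>vgap\<close>
  are left-invariant.\<close>

lemma left_invariant_const: "left_invariant (wave_dist (\<lambda>_. 1))"
proof -
  have "wave_dist (\<lambda>_. 1) (hmul g p) (hmul g q) = wave_dist (\<lambda>_. 1) p q" for g p q
  proof -
    have "hgap (hmul g p) (hmul g q) = hgap p q" "vgap (hmul g p) (hmul g q) = vgap p q"
      by (cases g; cases p; cases q; simp add: hgap_def vgap_def field_simps)+
    then show ?thesis by (simp add: wave_dist_def vertical_def growth_def profile_def)
  qed
  then show ?thesis by (simp add: left_invariant_def)
qed

lemma const_not_self_similar: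
  assumes "is_blow_up (wave_dist (\<lambda>_. 1)) D"
  shows "\<not> self_similar D"
proof -
  obtain r u v \<alpha> where r: "\<And>j::nat. 0 < r j"
    and cs: "\<And>s. (\<lambda>j. cos (s + ln (r j))) \<longlonglongrightarrow> cos (s + u)"
      "\<And>s. (\<lambda>j. sin (sqrt 2 * (s + ln (r j)))) \<longlonglongrightarrow> sin (sqrt 2 * s + v)"
    and pos: "\<And>x z. 0 < z \<Longrightarrow> 0 < vdist D x z"
    and lim: "\<And>x z. 0 < z \<Longrightarrow> (\<lambda>j. (vdist D x z)\<^sup>2 *
        profile (\<lambda>_. 1) (ln (vdist D x z) + ln (r j)) (2 * \<alpha> j + 2 * r j * x)) \<longlonglongrightarrow> z"
    using const.blow_up_profile[OF assms] by auto
  show ?thesis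
  proof (rule not_self_similar[of D u v])
    show "0 < vdist D x z \<and> z \<le> limit_growth u v 1 (vdist D x z)" if "0 < z" for x z
      using pos[OF that] const.vdist_le_limit_growth[OF cs lim[OF that]] by blast
    show "0 < limit_growth u v 1 a \<and> (\<exists>x. vdist D x (limit_growth u v 1 a) = a)" if "0 < a" for a
      using const.vdist_eq_of_wave_limit[where d = "vdist D 0", OF r cs pos lim that strict_mono_id tendsto_const]
      by blast
  qed
qed

text \<open>In blow-up coordinates the wave keeps a frequency comparable to \<open>1 / a\<close>, so
  moving \<open>x\<close> by a bounded amount reaches any prescribed phase \<open>\<theta>\<close>
  in the limit.\<close>

lemma sine_blow_up:
  assumes "is_blow_up (wave_dist sin) D"
  shows "\<exists>u v. (\<forall>x z. 0 < z \<longrightarrow> 0 < vdist D x z \<and> z \<le> limit_growth u v 1 (vdist D x z))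
    \<and> (\<forall>a \<theta>. 0 < a \<longrightarrow> 0 < limit_growth u v (sin \<theta>) a
      \<and> (\<exists>x. vdist D x (limit_growth u v (sin \<theta>) a) = a))
    \<and> (\<forall>x z z'. 0 < z \<longrightarrow> 0 < z' \<longrightarrow> vdist D x z = vdist D x z' \<longrightarrow> z = z')"
proof -
  obtain r u v \<alpha> where r: "\<And>j::nat. 0 < r j"
    and cs: "\<And>s. (\<lambda>j. cos (s + ln (r j))) \<longlonglongrightarrow> cos (s + u)"
      "\<And>s. (\<lambda>j. sin (sqrt 2 * (s + ln (r j)))) \<longlonglongrightarrow> sin (sqrt 2 * s + v)"
    and pos: "\<And>x z. 0 < z \<Longrightarrow> 0 < vdist D x z"
    and lim: "\<And>x z. 0 < z \<Longrightarrow> (\<lambda>j. (vdist D x z)\<^sup>2 *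
        profile sin (ln (vdist D x z) + ln (r j)) (2 * \<alpha> j + 2 * r j * x)) \<longlonglongrightarrow> z"
    using sine.blow_up_profile[OF assms] by auto
  show ?thesis
  proof (rule exI[of _ u], rule exI[of _ v], intro conjI allI impI)
    show "0 < vdist D x z" if "0 < z" for x z by (rule pos[OF that])
    show "z \<le> limit_growth u v 1 (vdist D x z)" if "0 < z" for x z
      by (rule sine.vdist_le_limit_growth[OF cs lim[OF that]])
    \<comment> \<open>Equal distances give the same sequence in \<open>lim\<close>, whose limit is
      unique.\<close>
    show "z = z'" if "0 < z" "0 < z'" "vdist D x z = vdist D x z'" for x z z'
      using LIMSEQ_unique[OF lim[OF that(1), of x]] lim[OF that(2), of x] that(3) by simp
    fix a \<theta> :: real assume "0 < a"
    define e where "e j = exp (- 2 * pi * of_int \<lfloor>(ln a + ln (r j)) / (2 * pi)\<rfloor>)" for j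
    obtain \<tau> \<rho> \<beta> where \<tau>: "strict_mono \<tau>" and \<rho>: "(\<lambda>j. mod_2pi (ln a + ln (r (\<tau> j)))) \<longlonglongrightarrow> \<rho>"
      and \<beta>: "(\<lambda>j. mod_2pi (2 * \<alpha> (\<tau> j) * e (\<tau> j))) \<longlonglongrightarrow> \<beta>"
      by (rule convergent_mod_2pi_subsequence[of "\<lambda>j. ln a + ln (r j)" "\<lambda>j. 2 * \<alpha> j * e j"])
    \<comment> \<open>\<open>r j * e j\<close> governs the rescaled frequency; the range of
      \<open>mod_2pi\<close> keeps it between \<open>1 / a\<close> and
      \<open>exp (2 * pi) / a\<close>.\<close>
    have re: "r j * e j = exp (mod_2pi (ln a + ln (r j))) / a" for j
    proof -
      have "exp (mod_2pi (ln a + ln (r j))) = exp (ln a) * exp (ln (r j)) * e j"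
        unfolding e_def exp_add[symmetric] by (simp add: mod_2pi_def)
      then show ?thesis using r[of j] \<open>0 < a\<close> by simp
    qed
    \<comment> \<open>Solves \<open>2 * x * (exp \<rho> / a) + \<beta> = \<theta>\<close>, the
      equation for the limit phase.\<close>
    define x where "x = (\<theta> - \<beta>) * a / (2 * exp \<rho>)"
    have phase: "sin ((2 * \<alpha> j + 2 * r j * x) * e j)
        = sin (2 * x * (exp (mod_2pi (ln a + ln (r j))) / a) + mod_2pi (2 * \<alpha> j * e j))" for j
      unfolding sin_add_mod_2pi re[symmetric] by (simp add: algebra_simps)
    have "(\<lambda>j. sin (2 * x * (exp (mod_2pi (ln a + ln (r (\<tau> j)))) / a) + mod_2pi (2 * \<alpha> (\<tau> j) * e (\<tau> j))))
        \<longlonglongrightarrow> sin (2 * x * (exp \<rho> / a) + \<beta>)"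
      using \<open>0 < a\<close> by (intro tendsto_intros \<rho> \<beta>) auto
    moreover have "2 * x * (exp \<rho> / a) + \<beta> = \<theta>"
      using \<open>0 < a\<close> by (simp add: x_def)
    ultimately have wave_lim: "(\<lambda>j. sin ((2 * \<alpha> (\<tau> j) + 2 * r (\<tau> j) * x) * e (\<tau> j))) \<longlonglongrightarrow> sin \<theta>"
      unfolding phase by simp
    note limits = sine.vdist_eq_of_wave_limit[where d = "vdist D x" and X = "\<lambda>j. 2 * \<alpha> j + 2 * r j * x",
        OF r cs pos lim \<open>0 < a\<close> \<tau> wave_lim[unfolded e_def]]
    show "0 < limit_growth u v (sin \<theta>) a" by (rule limits)
    show "\<exists>x. vdist D x (limit_growth u v (sin \<theta>) a) = a" by (rule exI) (rule limits)
  qed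
qed

lemma sine_not_self_similar:
  assumes "is_blow_up (wave_dist sin) D"
  shows "\<not> self_similar D"
proof -
  obtain u v where "\<forall>x z. 0 < z \<longrightarrow> 0 < vdist D x z \<and> z \<le> limit_growth u v 1 (vdist D x z)"
    and ex: "\<forall>a \<theta>. 0 < a \<longrightarrow> 0 < limit_growth u v (sin \<theta>) a
      \<and> (\<exists>x. vdist D x (limit_growth u v (sin \<theta>) a) = a)"
    using sine_blow_up[OF assms] by blast
  then show ?thesis
    using ex[THEN spec, THEN spec, of _ "pi / 2"] by (intro not_self_similar[of D u v]) auto
qed

text \<open>Left-invariance makes \<open>vdist\<close> independent of \<open>x\<close>. The wave
  values 1 and 0 then give two heights at the same distance over one base point, against
  injectivity.\<close>

lemma sine_not_left_invariant:
  assumes "is_blow_up (wave_dist sin) D"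
  shows "\<not> left_invariant D"
proof
  assume "left_invariant D"
  then have inv: "D (hmul g p) (hmul g q) = D p q" for g p q
    unfolding left_invariant_def by blast
  have vd: "vdist D x z = vdist D 0 z" for x z
    using inv[of "(x, 0, 0)" "(0, 0, 0)" "(0, 0, z)"] by (simp add: vdist_def)
  obtain u v where ex: "\<forall>a \<theta>. 0 < a \<longrightarrow> 0 < limit_growth u v (sin \<theta>) a
      \<and> (\<exists>x. vdist D x (limit_growth u v (sin \<theta>) a) = a)"
    and inj: "\<forall>x z z'. 0 < z \<longrightarrow> 0 < z' \<longrightarrow> vdist D x z = vdist D x z' \<longrightarrow> z = z'"
    using sine_blow_up[OF assms] by blast
  \<comment> \<open>Here \<open>ln a + u = pi\<close>, so the modulation factor
    \<open>1 - cos\<close> is 2 and the wave value matters.\<close>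
  define a where "a = exp (pi - u)"
  have "0 < a" by (simp add: a_def)
  have at: "0 < limit_growth u v (sin \<theta>) a" "vdist D 0 (limit_growth u v (sin \<theta>) a) = a" for \<theta>
    using ex \<open>0 < a\<close> vd by metis+
  have "limit_growth u v (sin (pi / 2)) a = limit_growth u v (sin 0) a"
    using inj at by metis
  then show False by (simp add: limit_growth_def a_def)
qed

theorem theorem1p5:
  shows "\<exists>d\<^sub>1 d\<^sub>2 :: heis \<Rightarrow> heis \<Rightarrow> real.
     Metric_space UNIV d\<^sub>1 \<and> bilipschitz_equiv d\<^sub>1 d_cc \<and>
     Metric_space UNIV d\<^sub>2 \<and> bilipschitz_equiv d\<^sub>2 d_cc \<and>
     (left_invariant d\<^sub>1 \<and> (\<forall>D. is_blow_up d\<^sub>1 D \<longrightarrow> \<not> self_similar D)) \<and>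
     (\<forall>D. is_blow_up d\<^sub>2 D \<longrightarrow> \<not> left_invariant D \<and> \<not> self_similar D)"
proof (rule exI[of _ "wave_dist (\<lambda>_. 1)"], rule exI[of _ "wave_dist sin"], intro conjI allI impI)
  fix D
  show "left_invariant (wave_dist (\<lambda>_. 1))" by (rule left_invariant_const)
  show "\<not> self_similar D" if "is_blow_up (wave_dist (\<lambda>_. 1)) D"
    using that by (rule const_not_self_similar)
  show "\<not> left_invariant D" "\<not> self_similar D" if "is_blow_up (wave_dist sin) D"
    using that by (rule sine_not_left_invariant, rule sine_not_self_similar)
qed (rule const.Metric_space_wave_dist const.bilipschitz_equiv_wave_dist
    sine.Metric_space_wave_dist sine.bilipschitz_equiv_wave_dist)+

end
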